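(* Let $\Sigma(A,B,B^* )$ be a minimal collocated skew-adjoint system on a Hilbert space $\mathcal Z$. Then the zeros of the system and the eigenvalues of $A$ lie on the imaginary axis, and the zeros interlace the eigenvalues. Moreover, each branch of the root locus lies in the closed left half plane. More precisely, if $k>0$ and $\lambda\in\sigma(A-kBB^* )$, then $\operatorname{Re}\lambda<0$.
   Context: $\mathcal Z$ is a complex Hilbert space. A system $\Sigma(A,B,C)$ consists of the generator $A:D(A)\subset\mathcal Z\to\mathcal Z$ of a $C_0$-semigroup on $\mathcal Z$ and bounded operators $B:\mathbb C\to\mathcal Z$, $Bu=bu$, and $C:\mathcal Z\to\mathbb C$, $Cx=\langle x,c\rangle$, with $b,c\in\mathcal Z$ and $B,C\neq0$. Standing assumption: $\sigma(A)$ is non-empty and consists only of isolated eigenvalues with finite algebraic multiplicity (so $\sigma(A)$ is finite or countable without finite accumulation point). The system is collocated skew-adjoint if $A^*=-A$ and $C=B^*$ (i.e. $c=b$). An invariant zero is a $\lambda\in\mathbb C$ for which there are a non-zero $x\in D(A)$ and a scalar $u$ with $(\lambda I-A)x-Bu=0$ and $Cx=0$. The system is minimal if no invariant zero belongs to $\sigma(A)$. For a minimal system the invariant zeros coincide with the transmission zeros, i.e. the $s\in\rho(A)$ with $G(s)=C(sI-A)^{-1}B=0$; these are the "zeros". "Interlace" means that zeros and eigenvalues alternate along the line. Root locus: let $\{\lambda_n\}$ be the eigenvalues of $A$ counted with multiplicity. The root locus is the family of curves (branches) $f_n:[0,\infty)\to\mathbb C$ with $f_n(0)=\lambda_n$,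 whose values $f_n(k)$ are the eigenvalues of $A-kBC$ (here $A-kBB^*$). *)

theory Defs
  imports "HOL-Analysis.Analysis"
begin

text \<open>
  The inner product is linear in its first argument. Positivity and definiteness are not
  listed because they follow from \<open>norm_eq_sqrt_cinner\<close> (in Isabelle the square root of a
  negative real is negative). Completeness comes from \<^class>\<open>banach\<close>.
\<close>

class chilbert_space = banach +
  fixes scaleC :: "complex \<Rightarrow> 'a \<Rightarrow> 'a"  (infixr \<open>*\<^sub>C\<close> 75)
    and cinner :: "'a \<Rightarrow> 'a \<Rightarrow> complex"
  assumes scaleC_add_right: "a *\<^sub>C (x + y) = a *\<^sub>C x + a *\<^sub>C y"
    and scaleC_add_left: "(a + b) *\<^sub>C x = a *\<^sub>C x + b *\<^sub>C x"
    and scaleC_scaleC: "a *\<^sub>C b *\<^sub>C x = (a * b) *\<^sub>C x"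
    and scaleR_scaleC: "r *\<^sub>R x = complex_of_real r *\<^sub>C x"
    and cinner_commute: "cinner x y = cnj (cinner y x)"
    and cinner_add_left: "cinner (x + y) z = cinner x z + cinner y z"
    and cinner_scaleC_left: "cinner (a *\<^sub>C x) y = a * cinner x y"
    and norm_eq_sqrt_cinner: "norm x = sqrt (Re (cinner x x))"

interpretation complex_vector: vector_space "scaleC :: complex \<Rightarrow> 'a \<Rightarrow> 'a::chilbert_space"
proof
  fix a b :: complex and x y :: 'a
  show "a *\<^sub>C (x + y) = a *\<^sub>C x + a *\<^sub>C y" by (rule scaleC_add_right)
  show "(a + b) *\<^sub>C x = a *\<^sub>C x + b *\<^sub>C x" by (rule scaleC_add_left)
  show "a *\<^sub>C b *\<^sub>C x = (a * b) *\<^sub>C x" by (rule scaleC_scaleC)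
  show "1 *\<^sub>C x = x" using scaleR_scaleC[of 1 x] by simp
qed

instantiation complex :: chilbert_space
begin

definition scaleC_complex :: "complex \<Rightarrow> complex \<Rightarrow> complex"
  where "scaleC_complex a x = a * x"

definition cinner_complex :: "complex \<Rightarrow> complex \<Rightarrow> complex"
  where "cinner_complex x y = x * cnj y"

instance
  by standard
    (auto simp: scaleC_complex_def cinner_complex_def algebra_simps scaleR_conv_of_real
      cmod_def power2_eq_square)

end

text \<open>
  An unbounded operator is given by its domain \<open>D\<close> and a map \<open>A\<close>, of which only the values on
  \<open>D\<close> matter.
\<close>

definition bounded_clinear :: "('a::chilbert_space \<Rightarrow> 'b::chilbert_space) \<Rightarrow> bool"
  where "bounded_clinear f \<longleftrightarrow> bounded_linear f \<and> (\<forall>a x. f (a *\<^sub>C x) = a *\<^sub>C f x)"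

definition C0_semigroup :: "(real \<Rightarrow> 'a \<Rightarrow> 'a::chilbert_space) \<Rightarrow> bool"
  where "C0_semigroup T \<longleftrightarrow>
    (\<forall>t\<ge>0. bounded_clinear (T t)) \<and>
    (\<forall>x. T 0 x = x) \<and>
    (\<forall>s\<ge>0. \<forall>t\<ge>0. \<forall>x. T (s + t) x = T s (T t x)) \<and>
    (\<forall>x. ((\<lambda>t. T t x) \<longlongrightarrow> x) (at_right 0))"

definition is_generator_of ::
    "'a::chilbert_space set \<Rightarrow> ('a \<Rightarrow> 'a) \<Rightarrow> (real \<Rightarrow> 'a \<Rightarrow> 'a) \<Rightarrow> bool"
  where "is_generator_of D A T \<longleftrightarrow>
    D = {x. \<exists>y. ((\<lambda>t. (T t x - x) /\<^sub>R t) \<longlongrightarrow> y) (at_right 0)} \<and>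
    (\<forall>x\<in>D. ((\<lambda>t. (T t x - x) /\<^sub>R t) \<longlongrightarrow> A x) (at_right 0))"

definition graph_on :: "'a set \<Rightarrow> ('a \<Rightarrow> 'b) \<Rightarrow> ('a \<times> 'b) set"
  where "graph_on D A = (\<lambda>x. (x, A x)) ` D"

text \<open>The graph of the adjoint, which is single-valued when \<open>D\<close> is dense.\<close>

definition adjoint_graph ::
    "'a::chilbert_space set \<Rightarrow> ('a \<Rightarrow> 'b::chilbert_space) \<Rightarrow> ('b \<times> 'a) set"
  where "adjoint_graph D A = {(y, z). \<forall>x\<in>D. cinner (A x) y = cinner x z}"

definition resolvent_set :: "'a::chilbert_space set \<Rightarrow> ('a \<Rightarrow> 'a) \<Rightarrow> complex set"
  where "resolvent_set D A =
    {s. bij_betw (\<lambda>x. s *\<^sub>C x - A x) D UNIV \<and>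
        bounded_clinear (inv_into D (\<lambda>x. s *\<^sub>C x - A x))}"

definition spectrum :: "'a::chilbert_space set \<Rightarrow> ('a \<Rightarrow> 'a) \<Rightarrow> complex set"
  where "spectrum D A = - resolvent_set D A"

definition eigenvalues :: "'a::chilbert_space set \<Rightarrow> ('a \<Rightarrow> 'a) \<Rightarrow> complex set"
  where "eigenvalues D A = {s. \<exists>x\<in>D. x \<noteq> 0 \<and> A x = s *\<^sub>C x}"

text \<open>\<open>kernel_power D A s n\<close> is the kernel of \<open>(s I - A)\<^sup>n\<close> on its natural domain.\<close>

primrec kernel_power ::
    "'a::chilbert_space set \<Rightarrow> ('a \<Rightarrow> 'a) \<Rightarrow> complex \<Rightarrow> nat \<Rightarrow> 'a set"
  where
    "kernel_power D A s 0 = {0}"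
  | "kernel_power D A s (Suc n) = {x\<in>D. s *\<^sub>C x - A x \<in> kernel_power D A s n}"

text \<open>The algebraic multiplicity is the complex dimension of the generalized eigenspace.\<close>

definition finite_algebraic_multiplicity ::
    "'a::chilbert_space set \<Rightarrow> ('a \<Rightarrow> 'a) \<Rightarrow> complex \<Rightarrow> bool"
  where "finite_algebraic_multiplicity D A s \<longleftrightarrow>
    (\<exists>S. finite S \<and> (\<Union>n. kernel_power D A s n) \<subseteq> complex_vector.span S)"

definition siso_system ::
    "'a::chilbert_space set \<Rightarrow> ('a \<Rightarrow> 'a) \<Rightarrow> (complex \<Rightarrow> 'a) \<Rightarrow> ('a \<Rightarrow> complex) \<Rightarrow> bool"
  where "siso_system D A B C \<longleftrightarrow>
    (\<exists>T. C0_semigroup T \<and> is_generator_of D A T) \<and>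
    (\<exists>b. b \<noteq> 0 \<and> B = (\<lambda>u. u *\<^sub>C b)) \<and>
    (\<exists>c. c \<noteq> 0 \<and> C = (\<lambda>x. cinner x c)) \<and>
    spectrum D A \<noteq> {} \<and>
    (\<forall>s\<in>spectrum D A. s isolated_in spectrum D A \<and> s \<in> eigenvalues D A \<and>
       finite_algebraic_multiplicity D A s)"

text \<open>\<open>A\<^sup>* = - A\<close> (with equality of domains) and \<open>C = B\<^sup>*\<close>.\<close>

definition collocated_skew_adjoint ::
    "'a::chilbert_space set \<Rightarrow> ('a \<Rightarrow> 'a) \<Rightarrow> (complex \<Rightarrow> 'a) \<Rightarrow> ('a \<Rightarrow> complex) \<Rightarrow> bool"
  where "collocated_skew_adjoint D A B C \<longleftrightarrow>
    adjoint_graph D A = graph_on D (\<lambda>x. - A x) \<and>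
    adjoint_graph UNIV B = graph_on UNIV C"

definition invariant_zeros ::
    "'a::chilbert_space set \<Rightarrow> ('a \<Rightarrow> 'a) \<Rightarrow> (complex \<Rightarrow> 'a) \<Rightarrow> ('a \<Rightarrow> complex) \<Rightarrow> complex set"
  where "invariant_zeros D A B C =
    {s. \<exists>x\<in>D. \<exists>u. x \<noteq> 0 \<and> (s *\<^sub>C x - A x) - B u = 0 \<and> C x = 0}"

definition minimal_system ::
    "'a::chilbert_space set \<Rightarrow> ('a \<Rightarrow> 'a) \<Rightarrow> (complex \<Rightarrow> 'a) \<Rightarrow> ('a \<Rightarrow> complex) \<Rightarrow> bool"
  where "minimal_system D A B C \<longleftrightarrow> invariant_zeros D A B C \<inter> spectrum D A = {}"

text \<open>The operator \<open>A - k B C\<close>; its domain is that of \<open>A\<close>.\<close>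

definition closed_loop ::
    "('a::chilbert_space \<Rightarrow> 'a) \<Rightarrow> (complex \<Rightarrow> 'a) \<Rightarrow> ('a \<Rightarrow> complex) \<Rightarrow> real \<Rightarrow> 'a \<Rightarrow> 'a"
  where "closed_loop A B C k = (\<lambda>x. A x - k *\<^sub>R B (C x))"

text \<open>
  A branch is a continuous curve of closed-loop eigenvalues that starts at an eigenvalue of
  \<open>A\<close>. Multiplicities only determine how often a curve is listed in the root locus, so every
  member of the root locus, however its curves are labelled at crossings, is a branch in this
  sense.
\<close>

definition root_locus_branch ::
    "'a::chilbert_space set \<Rightarrow> ('a \<Rightarrow> 'a) \<Rightarrow> (complex \<Rightarrow> 'a) \<Rightarrow> ('a \<Rightarrow> complex) \<Rightarrow>
     (real \<Rightarrow> complex) \<Rightarrow> bool"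
  where "root_locus_branch D A B C f \<longleftrightarrow>
    continuous_on {0..} f \<and> f 0 \<in> eigenvalues D A \<and>
    (\<forall>k\<ge>0. f k \<in> eigenvalues D (closed_loop A B C k))"

text \<open>
  Alternation along the line; meaningful for sets without finite accumulation points, such as
  the eigenvalues in a \<^const>\<open>siso_system\<close>.
\<close>

definition interlace :: "real set \<Rightarrow> real set \<Rightarrow> bool"
  where "interlace S T \<longleftrightarrow>
    S \<inter> T = {} \<and>
    (\<forall>x\<in>S. \<forall>y\<in>S. x < y \<longrightarrow> (\<exists>t\<in>T. x < t \<and> t < y)) \<and>
    (\<forall>x\<in>T. \<forall>y\<in>T. x < y \<longrightarrow> (\<exists>s\<in>S. x < s \<and> s < y))"

end

theory Submission
  imports Defs
begin

text \<open>
  Write \<open>A = i H\<close> with \<open>H\<close> self-adjoint. If \<open>x\<close> is a closed-loop eigenvector for \<open>s\<close>, then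
  \<open>Re s \<parallel>x\<parallel>\<^sup>2 = - k |\<langle>x, b\<rangle>|\<^sup>2\<close>, and minimality excludes \<open>\<langle>x, b\<rangle> = 0\<close> on the imaginary axis. To pass
  from eigenvalues to the spectrum, the closed-loop resolvent is written down explicitly: by the
  Sherman--Morrison formula at points of \<open>\<rho>(A)\<close>, and by solving separately along the eigenvector
  and in its orthogonal complement at eigenvalues of \<open>A\<close>. For the second case one needs that
  \<open>H - a\<close> is boundedly invertible on \<open>ker (H - a)\<^sup>\<bottom>\<close> when \<open>a\<close> is an isolated eigenvalue.

  Between eigenvalues, \<open>t \<mapsto> \<langle>(H - t)\<^sup>-\<^sup>1 b, b\<rangle>\<close> is real and strictly increasing, so it has at most
  one zero there; between consecutive eigenvalues it runs from \<open>-\<infinity>\<close> to \<open>\<infinity>\<close>, so it has one.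
\<close>

section \<open>Complex Hilbert spaces\<close>

lemma cinner_scaleC_right: "cinner (x::'a::chilbert_space) (a *\<^sub>C y) = cnj a * cinner x y"
  by (metis cinner_commute cinner_scaleC_left complex_cnj_mult)

lemma cinner_add_right: "cinner (x::'a::chilbert_space) (y + z) = cinner x y + cinner x z"
  by (metis cinner_commute cinner_add_left complex_cnj_add)

lemma cinner_self: "cinner (x::'a::chilbert_space) x = complex_of_real ((norm x)\<^sup>2)"
proof -
  have "cinner x x = cnj (cinner x x)" by (rule cinner_commute)
  then have "Im (cinner x x) = 0" by (simp add: complex_eq_iff)
  moreover have "Re (cinner x x) \<ge> 0"
    using norm_eq_sqrt_cinner[of x] norm_ge_zero[of x] by simp
  then have "Re (cinner x x) = (norm x)\<^sup>2" by (simp add: norm_eq_sqrt_cinner)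
  ultimately show ?thesis by (simp add: complex_eq_iff)
qed

lemma norm_scaleC: "norm (a *\<^sub>C (x::'a::chilbert_space)) = cmod a * norm x"
proof -
  have "complex_of_real ((norm (a *\<^sub>C x))\<^sup>2) = a * cnj a * complex_of_real ((norm x)\<^sup>2)"
    by (simp only: cinner_self[symmetric] cinner_scaleC_left cinner_scaleC_right mult_ac)
  also have "\<dots> = complex_of_real ((cmod a * norm x)\<^sup>2)"
    by (simp add: complex_norm_square[symmetric] power_mult_distrib)
  finally have "(norm (a *\<^sub>C x))\<^sup>2 = (cmod a * norm x)\<^sup>2"
    using of_real_eq_iff by blast
  then show ?thesis by simp
qed

lemma cinner_Cauchy_Schwarz: "cmod (cinner (x::'a::chilbert_space) y) \<le> norm x * norm y"
proof (cases "y = 0")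
  case True
  have "cinner x y = cinner x (0 *\<^sub>C y)" using True by simp
  also have "\<dots> = 0" by (simp only: cinner_scaleC_right) simp
  finally show ?thesis by simp
next
  case False
  define c where "c = cinner x y / complex_of_real ((norm y)\<^sup>2)"
  define z where "z = x + (- c) *\<^sub>C y"
  have c: "c * complex_of_real ((norm y)\<^sup>2) = cinner x y"
    using False by (simp add: c_def)
  have "cinner z y = 0"
    by (simp only: z_def cinner_add_left cinner_scaleC_left cinner_self) (simp add: c[symmetric])
  then have "cinner z z = cinner z x"
    unfolding z_def by (simp only: cinner_add_right cinner_scaleC_right) simp
  also have "\<dots> = cinner x x - c * cinner y x"
    by (simp only: z_def cinner_add_left cinner_scaleC_left) simp
  also have "cinner y x = cnj (cinner x y)" by (rule cinner_commute)
  also have "cinner x x - c * cnj (cinner x y)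
      = complex_of_real ((norm x)\<^sup>2 - (cmod (cinner x y))\<^sup>2 / (norm y)\<^sup>2)"
    by (simp add: c_def cinner_self complex_norm_square flip: complex_norm_square)
  finally have "(norm z)\<^sup>2 = (norm x)\<^sup>2 - (cmod (cinner x y))\<^sup>2 / (norm y)\<^sup>2"
    unfolding cinner_self of_real_eq_iff .
  then have "(cmod (cinner x y))\<^sup>2 / (norm y)\<^sup>2 \<le> (norm x)\<^sup>2"
    using zero_le_power2[of "norm z"] by linarith
  then have "(cmod (cinner x y))\<^sup>2 \<le> (norm x * norm y)\<^sup>2"
    using False by (simp add: power_mult_distrib divide_le_eq)
  then show ?thesis by (simp add: power2_le_iff_abs_le)
qed

interpretation cinner: bounded_bilinear "cinner :: 'a::chilbert_space \<Rightarrow> 'a \<Rightarrow> complex"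
proof
  fix x y z :: 'a and r :: real
  show "cinner (x + y) z = cinner x z + cinner y z" by (rule cinner_add_left)
  show "cinner x (y + z) = cinner x y + cinner x z" by (rule cinner_add_right)
  show "cinner (r *\<^sub>R x) y = r *\<^sub>R cinner x y"
    by (simp add: scaleR_scaleC[of r x] cinner_scaleC_left scaleR_conv_of_real)
  show "cinner x (r *\<^sub>R y) = r *\<^sub>R cinner x y"
    by (simp add: scaleR_scaleC[of r y] cinner_scaleC_right scaleR_conv_of_real)
  show "\<exists>K. \<forall>x y::'a. cmod (cinner x y) \<le> norm x * norm y * K"
    by (rule exI[of _ 1]) (simp add: cinner_Cauchy_Schwarz)
qed

interpretation scaleC: bounded_bilinear "scaleC :: complex \<Rightarrow> 'a::chilbert_space \<Rightarrow> 'a"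
proof
  fix x y :: 'a and a b :: complex and r :: real
  show "(a + b) *\<^sub>C x = a *\<^sub>C x + b *\<^sub>C x" by (rule scaleC_add_left)
  show "a *\<^sub>C (x + y) = a *\<^sub>C x + a *\<^sub>C y" by (rule scaleC_add_right)
  show "(r *\<^sub>R a) *\<^sub>C x = r *\<^sub>R (a *\<^sub>C x)"
    by (simp add: scaleR_scaleC[of r "a *\<^sub>C x"] scaleC_scaleC scaleR_conv_of_real)
  show "a *\<^sub>C (r *\<^sub>R x) = r *\<^sub>R (a *\<^sub>C x)"
    by (simp add: scaleR_scaleC scaleC_scaleC mult.commute)
  show "\<exists>K. \<forall>a (x::'a). norm (a *\<^sub>C x) \<le> norm a * norm x * K"
    by (rule exI[of _ 1]) (simp add: norm_scaleC)
qed

lemmas cinner_algebra = cinner.add_left cinner.add_right cinner.diff_left cinner.diff_right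
  cinner.minus_left cinner.minus_right cinner.scaleR_left cinner.scaleR_right
  cinner_scaleC_left cinner_scaleC_right

lemma Re_cinner_commute: "Re (cinner (x::'a::chilbert_space) y) = Re (cinner y x)"
  by (subst cinner_commute) simp

lemma power2_norm_add:
  "(norm ((x::'a::chilbert_space) + y))\<^sup>2 = (norm x)\<^sup>2 + 2 * Re (cinner x y) + (norm y)\<^sup>2"
proof -
  have "(norm (x + y))\<^sup>2 = Re (cinner (x + y) (x + y))" by (simp add: cinner_self)
  also have "\<dots> = (norm x)\<^sup>2 + Re (cinner x y) + Re (cinner y x) + (norm y)\<^sup>2"
    by (simp only: cinner_algebra) (simp add: cinner_self)
  also have "Re (cinner y x) = Re (cinner x y)" by (rule Re_cinner_commute)
  finally show ?thesis by simp
qed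

lemma power2_norm_diff:
  "(norm ((x::'a::chilbert_space) - y))\<^sup>2 = (norm x)\<^sup>2 - 2 * Re (cinner x y) + (norm y)\<^sup>2"
  using power2_norm_add[of x "- y"] by (simp add: cinner_algebra)

text \<open>Testing with \<open>v = x\<close> is enough. The lemma lets an operator be estimated
  after it has been moved to the other side of the inner product.\<close>

lemma norm_le_of_cinner_bound:
  assumes "c \<ge> 0" "\<And>v. Re (cinner x v) \<le> c * norm v"
  shows "norm (x::'a::chilbert_space) \<le> c"
proof (cases "x = 0")
  case False
  have "norm x * norm x \<le> c * norm x"
    using assms(2)[of x] by (simp add: cinner_self power2_eq_square)
  then show ?thesis using False by simp
qed (use assms in simp)

section \<open>Self-adjoint operators\<close>

locale selfadjoint =
  fixes D :: "'a::chilbert_space set" and H :: "'a \<Rightarrow> 'a"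
  assumes adjoint_graph_eq: "adjoint_graph D H = graph_on D H"
begin

text \<open>An adjoint relation is always linear and closed. Since here it is the graph of
  \<open>H\<close>, this one criterion yields that \<open>D\<close> is a subspace and that
  \<open>H\<close> is linear and closed.\<close>

lemma adjointI:
  assumes "\<And>x. x \<in> D \<Longrightarrow> cinner (H x) y = cinner x z"
  shows "y \<in> D \<and> H y = z"
proof -
  have "(y, z) \<in> graph_on D H"
    using assms by (simp add: adjoint_graph_eq[symmetric] adjoint_graph_def)
  then show ?thesis by (auto simp: graph_on_def)
qed

lemma H_symmetric:
  assumes "x \<in> D" "y \<in> D"
  shows "cinner (H x) y = cinner x (H y)"
proof -
  have "(y, H y) \<in> adjoint_graph D H"
    using assms by (simp add: adjoint_graph_eq graph_on_def)
  then show ?thesis using assms by (simp add: adjoint_graph_def)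
qed

lemma H_add:
  assumes "x \<in> D" "y \<in> D"
  shows "x + y \<in> D \<and> H (x + y) = H x + H y"
  by (rule adjointI) (simp add: cinner_algebra H_symmetric assms)

lemma H_scaleC:
  assumes "x \<in> D"
  shows "a *\<^sub>C x \<in> D \<and> H (a *\<^sub>C x) = a *\<^sub>C H x"
  by (rule adjointI) (simp add: cinner_algebra H_symmetric assms)

lemma H_scaleR:
  assumes "x \<in> D"
  shows "a *\<^sub>R x \<in> D \<and> H (a *\<^sub>R x) = a *\<^sub>R H x"
  by (rule adjointI) (simp add: cinner_algebra H_symmetric assms)

lemma H_diff:
  assumes "x \<in> D" "y \<in> D"
  shows "x - y \<in> D \<and> H (x - y) = H x - H y"
  by (rule adjointI) (simp add: cinner_algebra H_symmetric assms)

lemma H_closed: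
  assumes "\<And>n::nat. X n \<in> D" "X \<longlonglongrightarrow> x" "(\<lambda>n. H (X n)) \<longlonglongrightarrow> y"
  shows "x \<in> D \<and> H x = y"
proof (rule adjointI)
  fix z assume z: "z \<in> D"
  have "(\<lambda>n. cinner (H z) (X n)) \<longlonglongrightarrow> cinner (H z) x"
    by (intro tendsto_intros cinner.tendsto assms)
  moreover have "(\<lambda>n. cinner (H z) (X n)) \<longlonglongrightarrow> cinner z y"
    using cinner.tendsto[OF tendsto_const[of z] assms(3)] by (simp add: H_symmetric z assms(1))
  ultimately show "cinner (H z) x = cinner z y" by (rule LIMSEQ_unique)
qed

section \<open>Shifts, regular points and real resolvents\<close>

definition shift :: "real \<Rightarrow> 'a \<Rightarrow> 'a"
  where "shift t x = H x - t *\<^sub>R x"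

lemma shift_symmetric:
  assumes "x \<in> D" "y \<in> D"
  shows "cinner (shift t x) y = cinner x (shift t y)"
  by (simp add: shift_def cinner_algebra H_symmetric assms)

lemma shift_add: "x \<in> D \<Longrightarrow> y \<in> D \<Longrightarrow> shift t (x + y) = shift t x + shift t y"
  by (simp add: shift_def H_add algebra_simps)

lemma shift_diff: "x \<in> D \<Longrightarrow> y \<in> D \<Longrightarrow> shift t (x - y) = shift t x - shift t y"
  by (simp add: shift_def H_diff algebra_simps)

lemma shift_scaleR: "x \<in> D \<Longrightarrow> shift t (a *\<^sub>R x) = a *\<^sub>R shift t x"
  by (simp add: shift_def H_scaleR algebra_simps)

lemma shift_scaleC: "x \<in> D \<Longrightarrow> shift t (a *\<^sub>C x) = a *\<^sub>C shift t x"
  by (simp add: shift_def H_scaleC scaleC.scaleR_right scaleC.diff_right)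

lemma shift_shift: "shift s x = shift t x + (t - s) *\<^sub>R x"
  by (simp add: shift_def algebra_simps)

text \<open>For real \<open>t\<close>, this is membership in the resolvent set of \<open>H\<close>.
  Boundedness of the inverse is encoded as a lower bound for \<open>shift t\<close>, the form in
  which \<open>gap\<close> uses it.\<close>

definition regular :: "real \<Rightarrow> bool"
  where "regular t \<longleftrightarrow>
    (\<forall>v. \<exists>x\<in>D. shift t x = v) \<and> (\<exists>c>0. \<forall>x\<in>D. c * norm x \<le> norm (shift t x))"

text \<open>The sign is that of \<open>(H - t)\<^sup>-\<^sup>1\<close>. With this choice the
  derivative in \<open>t\<close> is the square of the resolvent, so its quadratic form
  increases.\<close>

definition resolvent :: "real \<Rightarrow> 'a \<Rightarrow> 'a"
  where "resolvent t v = (SOME x. x \<in> D \<and> shift t x = v)"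

lemma
  assumes "regular t"
  shows resolvent_in: "resolvent t v \<in> D"
    and shift_resolvent: "shift t (resolvent t v) = v"
proof -
  have "\<exists>x. x \<in> D \<and> shift t x = v" using assms by (auto simp: regular_def)
  from someI_ex[OF this] show "resolvent t v \<in> D" "shift t (resolvent t v) = v"
    by (auto simp: resolvent_def)
qed

lemma regular_inj:
  assumes "regular t" "x \<in> D" "y \<in> D" "shift t x = shift t y"
  shows "x = y"
proof -
  obtain c where "c > 0" "\<And>z. z \<in> D \<Longrightarrow> c * norm z \<le> norm (shift t z)"
    using assms(1) by (auto simp: regular_def)
  from this(1) this(2)[of "x - y"] show ?thesis
    using assms by (simp add: H_diff shift_diff mult_le_0_iff)
qed

lemma resolvent_eqI:
  assumes "regular t" "x \<in> D" "shift t x = v"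
  shows "resolvent t v = x"
  using regular_inj[OF assms(1)] resolvent_in[OF assms(1)] shift_resolvent[OF assms(1)] assms
  by blast

lemma resolvent_bounded_linear:
  assumes t: "regular t"
  shows "bounded_linear (resolvent t)"
proof -
  obtain c where c: "c > 0" "\<And>z. z \<in> D \<Longrightarrow> c * norm z \<le> norm (shift t z)"
    using t by (auto simp: regular_def)
  show ?thesis
  proof (rule bounded_linear_intro)
    show "resolvent t (x + y) = resolvent t x + resolvent t y" for x y
      by (rule resolvent_eqI[OF t])
        (simp_all add: H_add shift_add resolvent_in[OF t] shift_resolvent[OF t])
    show "resolvent t (r *\<^sub>R x) = r *\<^sub>R resolvent t x" for r x
      by (rule resolvent_eqI[OF t])
        (simp_all add: H_scaleR shift_scaleR resolvent_in[OF t] shift_resolvent[OF t])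
    show "norm (resolvent t x) \<le> norm x * (1 / c)" for x
      using c(1) c(2)[OF resolvent_in[OF t, of x]]
      by (simp add: shift_resolvent[OF t] field_simps)
  qed
qed

lemma resolvent_symmetric:
  assumes "regular t"
  shows "cinner (resolvent t x) y = cinner x (resolvent t y)"
  using shift_symmetric[OF resolvent_in resolvent_in, OF assms assms, of t x y]
  by (simp add: shift_resolvent assms)

text \<open>The first resolvent identity: \<open>shift s\<close> maps the left side to
  \<open>(s - t) *\<^sub>R resolvent t v\<close>.\<close>

lemma resolvent_diff:
  assumes "regular s" "regular t"
  shows "resolvent s v - resolvent t v = (s - t) *\<^sub>R resolvent s (resolvent t v)"
proof -
  have "resolvent s ((s - t) *\<^sub>R resolvent t v) = resolvent s v - resolvent t v"
  proof (rule resolvent_eqI)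
    show "shift s (resolvent s v - resolvent t v) = (s - t) *\<^sub>R resolvent t v"
      using shift_shift[of s "resolvent t v" t]
      by (simp add: shift_diff resolvent_in shift_resolvent assms algebra_simps)
  qed (simp_all add: assms H_diff resolvent_in)
  then show ?thesis
    by (simp add: bounded_linear.linear linear_scale resolvent_bounded_linear assms)
qed

text \<open>
  Let \<open>S = (H - t)\<^sup>-\<^sup>1\<close>, \<open>K = \<parallel>S\<parallel>\<close> and \<open>m = 1 / K\<close>. If \<open>m < d\<close>, then \<open>t \<plusminus> m\<close> are regular, so \<open>1 - m\<^sup>2 S\<^sup>2\<close>
  is bounded below, whereas it nearly annihilates vectors on which \<open>S\<close> nearly attains its norm.
  The constant \<open>q\<close> below makes this quantitative.
\<close>

lemma gap:
  assumes reg: "\<And>s. \<bar>s - t\<bar> < d \<Longrightarrow> regular s" and d: "d > 0" and x: "x \<in> D"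
  shows "d * norm x \<le> norm (shift t x)"
proof -
  have t: "regular t" by (rule reg) (simp add: d)
  let ?S = "resolvent t"
  define K where "K = onorm ?S"
  note bl = resolvent_bounded_linear[OF t]
  have K: "norm (?S y) \<le> K * norm y" for y
    unfolding K_def by (rule onorm[OF bl])
  have K0: "K \<ge> 0" unfolding K_def by (rule onorm_pos_le[OF bl])
  have "K * d \<le> 1"
  proof (rule ccontr)
    assume *: "\<not> K * d \<le> 1"
    then have Kpos: "K > 0" using K0 d by (cases "K = 0") auto
    define m where "m = 1 / K"
    have m: "0 < m" "m < d" "m * K = 1" using Kpos * by (auto simp: m_def field_simps)
    have "regular (t + m)" "regular (t - m)" by (rule reg; use m in simp)+
    then obtain c1 c2 where c: "c1 > 0" "c2 > 0"
      and c1: "\<And>z. z \<in> D \<Longrightarrow> c1 * norm z \<le> norm (shift (t + m) z)"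
      and c2: "\<And>z. z \<in> D \<Longrightarrow> c2 * norm z \<le> norm (shift (t - m) z)"
      by (auto simp: regular_def)
    define q where "q = 1 / (1 + m\<^sup>2 / (c1 * c2))"
    have "m\<^sup>2 / (c1 * c2) > 0" using c m by simp
    then have q: "0 < q" "q < 1" unfolding q_def by auto
    have main: "norm (?S y) \<le> K * sqrt (1 - q\<^sup>2) * norm y" for y
    proof -
      define w where "w = y - (m\<^sup>2) *\<^sub>R ?S (?S y)"
      have s1: "shift (t + m) (?S z) = z - m *\<^sub>R ?S z" for z
        using shift_shift[of "t + m" "?S z" t] by (simp add: shift_resolvent t)
      have s2: "shift (t - m) (?S z) = z + m *\<^sub>R ?S z" for z
        using shift_shift[of "t - m" "?S z" t] by (simp add: shift_resolvent t)
      have lin: "?S (z + r *\<^sub>R z') = ?S z + r *\<^sub>R ?S z'" for z z' r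
        using bl by (simp add: bounded_linear.linear linear_add linear_scale)
      \<comment> \<open>Here \<open>w = (1 - m S) (1 + m S) y\<close>. The lower bounds at
        \<open>t + m\<close> and \<open>t - m\<close> remove one factor each; they hold on
        \<open>D\<close>, which is why the estimate is for \<open>S (S y)\<close> and not for
        \<open>y\<close>.\<close>
      have "shift (t + m) (?S (y + m *\<^sub>R ?S y)) = w"
        by (subst s1) (simp add: lin w_def power2_eq_square algebra_simps)
      then have "c1 * norm (?S (y + m *\<^sub>R ?S y)) \<le> norm w"
        using c1[OF resolvent_in[OF t, of "y + m *\<^sub>R ?S y"]] by simp
      moreover have "c2 * norm (?S (?S y)) \<le> norm (?S (y + m *\<^sub>R ?S y))"
        using c2[OF resolvent_in[OF t, of "?S y"]] by (simp add: s2 lin)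
      ultimately have "c1 * (c2 * norm (?S (?S y))) \<le> norm w"
        using c by (meson mult_left_mono less_imp_le order_trans)
      then have S2: "norm (?S (?S y)) \<le> norm w / (c1 * c2)"
        using c by (simp add: field_simps)
      have "norm y = norm (w + m\<^sup>2 *\<^sub>R ?S (?S y))" by (simp add: w_def)
      also have "\<dots> \<le> norm w + m\<^sup>2 * norm (?S (?S y))"
        by (metis abs_power2 norm_scaleR norm_triangle_ineq)
      also have "\<dots> \<le> norm w + m\<^sup>2 * (norm w / (c1 * c2))"
        using mult_left_mono[OF S2, of "m\<^sup>2"] by simp
      also have "\<dots> = norm w / q" by (simp add: q_def algebra_simps)
      finally have "q * norm y \<le> norm w" using q by (simp add: field_simps)
      then have "(q * norm y)\<^sup>2 \<le> (norm w)\<^sup>2" using q by (intro power_mono) auto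
      \<comment> \<open>By symmetry of \<open>S\<close> the cross term is a multiple of the squared
        norm of \<open>S y\<close>. Because \<open>m * K = 1\<close>, the last square can absorb at
        most half of it.\<close>
      also have "(norm w)\<^sup>2 = (norm y)\<^sup>2 - 2 * m\<^sup>2 * (norm (?S y))\<^sup>2 + (m\<^sup>2 * norm (?S (?S y)))\<^sup>2"
        using resolvent_symmetric[OF t, of "?S y" y]
        by (simp add: w_def power2_norm_diff cinner_algebra cinner_self
            resolvent_symmetric[OF t, symmetric] Re_cinner_commute)
      also have "m\<^sup>2 * norm (?S (?S y)) \<le> m * norm (?S y)"
      proof -
        have "m * norm (?S (?S y)) \<le> m * (K * norm (?S y))"
          using K m by (intro mult_left_mono) auto
        also have "\<dots> = norm (?S y)" using m by (simp add: mult.assoc[symmetric])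
        finally show ?thesis using m by (simp add: power2_eq_square mult.assoc)
      qed
      then have "(m\<^sup>2 * norm (?S (?S y)))\<^sup>2 \<le> m\<^sup>2 * (norm (?S y))\<^sup>2"
        using power_mono[of "m\<^sup>2 * norm (?S (?S y))" "m * norm (?S y)" 2]
        by (simp add: power_mult_distrib)
      finally have "m\<^sup>2 * (norm (?S y))\<^sup>2 \<le> (1 - q\<^sup>2) * (norm y)\<^sup>2"
        by (simp add: algebra_simps power_mult_distrib)
      then have "K\<^sup>2 * (m\<^sup>2 * (norm (?S y))\<^sup>2) \<le> K\<^sup>2 * ((1 - q\<^sup>2) * (norm y)\<^sup>2)"
        by (rule mult_left_mono) simp
      moreover have "K\<^sup>2 * (m\<^sup>2 * (norm (?S y))\<^sup>2) = (norm (?S y))\<^sup>2"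
        using m by (simp add: mult.assoc[symmetric] power_mult_distrib[symmetric] mult.commute)
      moreover have "q\<^sup>2 \<le> 1" using q by (simp add: power_le_one)
      then have "K\<^sup>2 * ((1 - q\<^sup>2) * (norm y)\<^sup>2) = (K * sqrt (1 - q\<^sup>2) * norm y)\<^sup>2"
        by (simp add: power_mult_distrib)
      ultimately have "(norm (?S y))\<^sup>2 \<le> (K * sqrt (1 - q\<^sup>2) * norm y)\<^sup>2" by simp
      then show ?thesis
        using K0 \<open>q\<^sup>2 \<le> 1\<close> by (auto intro: power2_le_imp_le)
    qed
    have "K \<le> K * sqrt (1 - q\<^sup>2)"
      unfolding K_def
    proof (rule onorm_bound)
      show "0 \<le> onorm ?S * sqrt (1 - q\<^sup>2)"
        using K0 q by (simp add: K_def power_le_one)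
      show "norm (?S y) \<le> onorm ?S * sqrt (1 - q\<^sup>2) * norm y" for y
        using main[of y] by (simp add: K_def)
    qed
    moreover have "sqrt (1 - q\<^sup>2) < 1" using q by simp
    ultimately show False using Kpos by simp
  qed
  have "?S (shift t x) = x" by (rule resolvent_eqI[OF t x refl])
  then have "norm x \<le> K * norm (shift t x)" using K[of "shift t x"] by simp
  then have "d * norm x \<le> d * (K * norm (shift t x))" using d by simp
  also have "\<dots> \<le> 1 * norm (shift t x)"
    using \<open>K * d \<le> 1\<close> mult_right_mono[of "K * d" 1 "norm (shift t x)"] by (simp add: mult_ac)
  finally show ?thesis by simp
qed

lemma gap_resolvent:
  assumes "\<And>s. \<bar>s - t\<bar> < d \<Longrightarrow> regular s" "d > 0"
  shows "norm (resolvent t v) \<le> norm v / d"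
proof -
  have t: "regular t" by (rule assms) (simp add: assms)
  have "d * norm (resolvent t v) \<le> norm v"
    using gap[of t d "resolvent t v"] assms resolvent_in[OF t] by (simp add: shift_resolvent[OF t])
  then show ?thesis using assms(2) by (simp add: field_simps)
qed

text \<open>With midpoint \<open>t\<close> and half-length \<open>d\<close>,
  \<open>(H - a) (H - b) = (H - t)\<^sup>2 - d\<^sup>2\<close>, and \<open>gap\<close> bounds the
  first term below by \<open>(d + \<epsilon>)\<^sup>2\<close>. The margin
  \<open>\<epsilon> > 0\<close> serves strict monotonicity; \<open>\<epsilon> = 0\<close> serves
  intervals with an eigenvalue at an end.\<close>

lemma gap_cinner:
  assumes reg: "\<And>s. a - \<epsilon> < s \<Longrightarrow> s < b + \<epsilon> \<Longrightarrow> regular s"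
    and ab: "a \<le> b" "\<epsilon> \<ge> 0" "a < b + \<epsilon>" and x: "x \<in> D"
  shows "Re (cinner (shift a x) (shift b x)) \<ge> \<epsilon> * (b - a + \<epsilon>) * (norm x)\<^sup>2"
proof -
  define t where "t = (a + b) / 2"
  define d where "d = (b - a) / 2"
  have "(d + \<epsilon>) * norm x \<le> norm (shift t x)"
  proof (rule gap[OF _ _ x])
    show "regular s" if "\<bar>s - t\<bar> < d + \<epsilon>" for s
      by (rule reg) (use that in \<open>auto simp: t_def d_def field_simps abs_less_iff\<close>)
    show "d + \<epsilon> > 0" using ab by (auto simp: d_def field_simps)
  qed
  then have "((d + \<epsilon>) * norm x)\<^sup>2 \<le> (norm (shift t x))\<^sup>2"
    using ab by (intro power_mono) (auto simp: d_def)
  moreover have "shift a x = shift t x + d *\<^sub>R x" "shift b x = shift t x - d *\<^sub>R x"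
  proof -
    have "t - a = d" "t - b = - d" by (simp_all add: t_def d_def field_simps)
    then show "shift a x = shift t x + d *\<^sub>R x" "shift b x = shift t x - d *\<^sub>R x"
      using shift_shift[of a x t] shift_shift[of b x t] by simp_all
  qed
  then have "Re (cinner (shift a x) (shift b x)) = (norm (shift t x))\<^sup>2 - d\<^sup>2 * (norm x)\<^sup>2"
    using Re_cinner_commute[of x "shift t x"]
    by (simp only: cinner_algebra) (simp add: cinner_self power2_eq_square algebra_simps)
  moreover have eq: "\<epsilon> * (b - a + \<epsilon>) = (d + \<epsilon>)\<^sup>2 - d\<^sup>2"
    by (simp add: d_def power2_eq_square field_simps)
  ultimately show ?thesis unfolding eq power_mult_distrib left_diff_distrib by linarith
qed

definition eigenvalue :: "real \<Rightarrow> bool"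
  where "eigenvalue t \<longleftrightarrow> (\<exists>x\<in>D. x \<noteq> 0 \<and> shift t x = 0)"

lemma regular_not_eigenvalue: "regular t \<Longrightarrow> \<not> eigenvalue t"
  by (auto simp: regular_def eigenvalue_def mult_le_0_iff dest!: bspec)

end

section \<open>Self-adjoint operators whose real spectrum consists of isolated eigenvalues\<close>

locale discrete_selfadjoint = selfadjoint +
  assumes regularI: "\<not> eigenvalue t \<Longrightarrow> regular t"
    and eigenvalue_isolated:
      "eigenvalue t \<Longrightarrow> \<exists>\<delta>>0. \<forall>s. s \<noteq> t \<longrightarrow> \<bar>s - t\<bar> < \<delta> \<longrightarrow> \<not> eigenvalue s"
begin

text \<open>An eigenvector at \<open>s\<close> is multiplied by \<open>s - t\<close> under
  \<open>shift t\<close>, against the lower bound \<open>c\<close> when \<open>s\<close> is closer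
  to \<open>t\<close> than \<open>c\<close>.\<close>

lemma regular_open:
  assumes "regular t"
  shows "\<exists>\<epsilon>>0. \<forall>s. \<bar>s - t\<bar> < \<epsilon> \<longrightarrow> regular s"
proof -
  obtain c where c: "c > 0" "\<And>x. x \<in> D \<Longrightarrow> c * norm x \<le> norm (shift t x)"
    using assms by (auto simp: regular_def)
  have "regular s" if s: "\<bar>s - t\<bar> < c" for s
  proof (rule regularI, rule notI)
    assume "eigenvalue s"
    then obtain x where x: "x \<in> D" "x \<noteq> 0" "shift s x = 0" by (auto simp: eigenvalue_def)
    have "norm (shift t x) = \<bar>s - t\<bar> * norm x"
      using shift_shift[of t x s] x by simp
    with c(2)[OF x(1)] s x show False by simp
  qed
  with c(1) show ?thesis by blast
qed

text \<open>By the resolvent identity the increment is \<open>b - a\<close> times the real part of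
  \<open>cinner x v\<close>. That inner product equals
  \<open>cinner (shift a x) (shift b x)\<close>, so \<open>gap_cinner\<close> applies; strictness
  comes from the margin that openness provides beyond both ends.\<close>

lemma cinner_resolvent_strict_mono:
  assumes reg: "\<And>s. a \<le> s \<Longrightarrow> s \<le> b \<Longrightarrow> regular s" and "a < b" "v \<noteq> 0"
  shows "Re (cinner (resolvent a v) v) < Re (cinner (resolvent b v) v)"
proof -
  have a: "regular a" and b: "regular b" using assms by auto
  obtain e1 where e1: "e1 > 0" "\<And>s. \<bar>s - a\<bar> < e1 \<Longrightarrow> regular s" using regular_open[OF a] by auto
  obtain e2 where e2: "e2 > 0" "\<And>s. \<bar>s - b\<bar> < e2 \<Longrightarrow> regular s" using regular_open[OF b] by auto
  define \<epsilon> where "\<epsilon> = min e1 e2"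
  have eps: "\<epsilon> > 0" using e1 e2 by (simp add: \<epsilon>_def)
  define x where "x = resolvent a (resolvent b v)"
  have x: "x \<in> D" "shift a x = resolvent b v"
    by (simp_all add: x_def resolvent_in shift_resolvent a)
  have diff: "(b - a) *\<^sub>R x = resolvent b v - resolvent a v"
    using resolvent_diff[OF a b, of v] by (simp add: x_def algebra_simps)
  have xb: "shift b x = resolvent a v"
  proof -
    have "shift b x = resolvent b v - (b - a) *\<^sub>R x"
      using shift_shift[of b x a] x by (simp add: algebra_simps)
    then show ?thesis by (simp add: diff)
  qed
  have "x \<noteq> 0"
  proof
    assume "x = 0"
    then have "resolvent b v = 0" using x shift_diff[OF x(1) x(1), of a] by simp
    then show False
      using shift_resolvent[OF b, of v] shift_diff[OF x(1) x(1), of b] \<open>v \<noteq> 0\<close> \<open>x = 0\<close> by simp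
  qed
  have "regular s" if "a - \<epsilon> < s" "s < b + \<epsilon>" for s
    using e1(2)[of s] e2(2)[of s] reg[of s] that
    by (cases "s < a"; cases "s > b") (auto simp: \<epsilon>_def)
  from gap_cinner[of a \<epsilon> b x, OF this]
  have "\<epsilon> * (b - a + \<epsilon>) * (norm x)\<^sup>2 \<le> Re (cinner (resolvent b v) (resolvent a v))"
    using eps \<open>a < b\<close> x xb by simp
  moreover have "\<epsilon> * (b - a + \<epsilon>) * (norm x)\<^sup>2 > 0"
    using eps \<open>a < b\<close> \<open>x \<noteq> 0\<close> by simp
  ultimately have "0 < (b - a) * Re (cinner (resolvent b v) (resolvent a v))"
    using \<open>a < b\<close> by simp
  also have "cinner (resolvent b v) (resolvent a v) = cinner x v"
    by (simp add: x_def resolvent_symmetric a)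
  also have "(b - a) * Re (cinner x v) = Re (cinner ((b - a) *\<^sub>R x) v)"
    by (simp only: cinner.scaleR_left) simp
  also have "\<dots> = Re (cinner (resolvent b v) v) - Re (cinner (resolvent a v) v)"
    unfolding diff by (simp add: cinner.diff_left)
  finally show ?thesis by simp
qed

text \<open>This form admits \<open>v = 0\<close>, which can occur for the remainder
  \<open>w\<close> in \<open>cinner_resolvent_zero\<close>.\<close>

lemma cinner_resolvent_mono:
  assumes "\<And>s. a \<le> s \<Longrightarrow> s \<le> b \<Longrightarrow> regular s" and "a \<le> b"
  shows "Re (cinner (resolvent a v) v) \<le> Re (cinner (resolvent b v) v)"
  using cinner_resolvent_strict_mono[of a b v] assms
  by (cases "a = b"; cases "v = 0") (auto simp: cinner.zero_right intro: less_imp_le)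

text \<open>All points of \<open>{p..q}\<close> keep distance \<open>r\<close> from \<open>a\<close>
  and \<open>c\<close>, so \<open>gap_resolvent\<close> bounds the resolvents there by
  \<open>1 / r\<close>. The resolvent identity then gives a Lipschitz constant.\<close>

lemma cinner_resolvent_continuous:
  assumes reg: "\<And>s. a < s \<Longrightarrow> s < c \<Longrightarrow> regular s" and "a < p" "p \<le> q" "q < c"
  shows "continuous_on {p..q} (\<lambda>t. Re (cinner (resolvent t v) v))"
proof -
  define r where "r = min (p - a) (c - q)"
  have r: "r > 0" using assms by (simp add: r_def)
  have regpq: "regular t" if "t \<in> {p..q}" for t by (rule reg) (use that assms in auto)
  have bound: "norm (resolvent t w) \<le> norm w / r" if "t \<in> {p..q}" for t w
    by (rule gap_resolvent[OF reg r]) (use that in \<open>auto simp: r_def\<close>)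
  have "\<bar>Re (cinner (resolvent s v) v) - Re (cinner (resolvent t v) v)\<bar>
      \<le> ((norm v)\<^sup>2 / r\<^sup>2) * \<bar>s - t\<bar>" if s: "s \<in> {p..q}" and t: "t \<in> {p..q}" for s t
  proof -
    have "\<bar>Re (cinner (resolvent s v) v) - Re (cinner (resolvent t v) v)\<bar>
        = \<bar>Re (cinner (resolvent s v - resolvent t v) v)\<bar>"
      by (simp add: cinner.diff_left)
    also have "\<dots> \<le> norm (resolvent s v - resolvent t v) * norm v"
      using abs_Re_le_cmod cinner_Cauchy_Schwarz order_trans by blast
    also have "\<dots> = \<bar>s - t\<bar> * norm (resolvent s (resolvent t v)) * norm v"
      by (simp add: resolvent_diff[OF regpq[OF s] regpq[OF t]])
    also have "\<dots> \<le> \<bar>s - t\<bar> * (norm v / r / r) * norm v"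
      using order_trans[OF bound[OF s, of "resolvent t v"] divide_right_mono[OF bound[OF t, of v]]] r
      by (intro mult_left_mono mult_right_mono) auto
    finally show ?thesis by (simp add: power2_eq_square mult_ac)
  qed
  then have "((norm v)\<^sup>2 / r\<^sup>2)-lipschitz_on {p..q} (\<lambda>t. Re (cinner (resolvent t v) v))"
    by (intro lipschitz_onI) (auto simp: dist_real_def)
  then show ?thesis by (rule lipschitz_on_continuous_on)
qed

text \<open>The infimum of the eigenvalues to the right of \<open>a\<close> works: isolation of
  \<open>a\<close> keeps it away from \<open>a\<close>, and openness of the regular set makes it an
  eigenvalue itself.\<close>

lemma next_eigenvalue:
  assumes "eigenvalue a" "eigenvalue b" "a < b"
  obtains c where "a < c" "c \<le> b" "eigenvalue c" "\<And>s. a < s \<Longrightarrow> s < c \<Longrightarrow> regular s"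
proof -
  define E where "E = {s. eigenvalue s \<and> a < s}"
  define c where "c = Inf E"
  have E: "b \<in> E" using assms by (simp add: E_def)
  have bdd: "bdd_below E" by (auto simp: E_def intro!: bdd_belowI[of _ a])
  obtain \<delta> where d: "\<delta> > 0" "\<And>s. s \<noteq> a \<Longrightarrow> \<bar>s - a\<bar> < \<delta> \<Longrightarrow> \<not> eigenvalue s"
    using eigenvalue_isolated[OF assms(1)] by auto
  have "a + \<delta> \<le> c"
    unfolding c_def
  proof (rule cInf_greatest)
    show "a + \<delta> \<le> s" if "s \<in> E" for s
      using that d(2)[of s] by (cases "s < a + \<delta>") (auto simp: E_def)
  qed (use E in auto)
  then have 1: "a < c" using d by simp
  have 2: "c \<le> b" unfolding c_def by (rule cInf_lower[OF E bdd])
  have 3: "regular s" if "a < s" "s < c" for s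
    using that cInf_lower[OF _ bdd, of s] by (intro regularI) (auto simp: E_def c_def)
  have "eigenvalue c"
  proof (rule ccontr)
    assume "\<not> eigenvalue c"
    from regular_open[OF regularI[OF this]]
    obtain e where e: "e > 0" "\<And>s. \<bar>s - c\<bar> < e \<Longrightarrow> regular s" by auto
    have "c + e \<le> c"
    proof (subst (2) c_def, rule cInf_greatest)
      show "c + e \<le> s" if "s \<in> E" for s
        using that cInf_lower[OF that bdd] e(2)[of s] regular_not_eigenvalue[of s]
        by (cases "s < c + e") (auto simp: E_def c_def)
    qed (use E in auto)
    then show False using e by simp
  qed
  with 1 2 3 that show ?thesis by blast
qed

text \<open>Splitting \<open>v\<close> along an eigenvector that is not orthogonal to it exposes a
  pole at each end. The signs of the poles are opposite as seen from inside the interval, and the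
  intermediate value theorem applies.\<close>

lemma cinner_resolvent_zero:
  assumes reg: "\<And>s. a < s \<Longrightarrow> s < c \<Longrightarrow> regular s" and "a < c"
    and e: "e \<in> D" "shift a e = 0" "cinner e v \<noteq> 0"
    and f: "f \<in> D" "shift c f = 0" "cinner f v \<noteq> 0"
  shows "\<exists>t. a < t \<and> t < c \<and> cinner (resolvent t v) v = 0"
proof -
  let ?G = "\<lambda>v t. Re (cinner (resolvent t v) v)"
  define m where "m = (a + c) / 2"
  have m: "a < m" "m < c" using \<open>a < c\<close> by (auto simp: m_def)
  \<comment> \<open>The summand \<open>?G w\<close> is monotone, hence bounded on the side that could cancel the pole.\<close>
  have split: "\<exists>\<gamma>>0. \<exists>w. \<forall>t. a < t \<longrightarrow> t < c \<longrightarrow> ?G v t = \<gamma> / (s - t) + ?G w t"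
    if s: "s = a \<or> s = c" and g: "g \<in> D" "shift s g = 0" "cinner g v \<noteq> 0" for s g
  proof -
    have g0: "g \<noteq> 0" using g(3) by (auto simp: cinner.zero_left)
    \<comment> \<open>\<open>\<beta> *\<^sub>C g\<close> is the orthogonal projection of
      \<open>v\<close> onto the line of \<open>g\<close>. The resolvent acts on it as the scalar
      \<open>1 / (s - t)\<close> and preserves orthogonality to \<open>g\<close>, so no mixed terms
      appear.\<close>
    define \<beta> where "\<beta> = cinner v g / complex_of_real ((norm g)\<^sup>2)"
    define w where "w = v - \<beta> *\<^sub>C g"
    have wg: "cinner w g = 0"
      using g0 by (simp add: w_def cinner_algebra cinner_self \<beta>_def)
    have gw: "cinner g w = 0" using wg cinner_commute[of g w] by simp
    have b0: "\<beta> \<noteq> 0" using g0 g(3) cinner_commute[of g v] by (auto simp: \<beta>_def)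
    have vw: "v = \<beta> *\<^sub>C g + w" by (simp add: w_def)
    have "?G v t = ((cmod \<beta>)\<^sup>2 * (norm g)\<^sup>2) / (s - t) + ?G w t" if t: "a < t" "t < c" for t
    proof -
      have rt: "regular t" using reg t by simp
      have ne: "s - t \<noteq> 0" using s t by auto
      define h where "h = (1 / (s - t)) *\<^sub>R (\<beta> *\<^sub>C g)"
      have hD: "h \<in> D" by (simp add: h_def H_scaleC H_scaleR g)
      have "shift t h = \<beta> *\<^sub>C g"
        using shift_shift[of t g s] ne g
        by (simp add: h_def shift_scaleR shift_scaleC H_scaleC scaleC.scaleR_right)
      then have "resolvent t (\<beta> *\<^sub>C g) = h" by (rule resolvent_eqI[OF rt hD])
      then have rv: "resolvent t v = h + resolvent t w"
        using resolvent_bounded_linear[OF rt] by (subst vw) (simp add: bounded_linear.linear linear_add)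
      have "resolvent t g = (1 / (s - t)) *\<^sub>R g"
        by (rule resolvent_eqI[OF rt]) (use g ne shift_shift[of t g s] in \<open>simp_all add: H_scaleR shift_scaleR\<close>)
      then have "cinner (resolvent t w) g = 0"
        by (simp add: resolvent_symmetric[OF rt] cinner_algebra wg)
      then have "cinner (resolvent t v) v = cinner h (\<beta> *\<^sub>C g) + cinner (resolvent t w) w"
        unfolding rv by (subst vw) (simp add: cinner_algebra h_def gw)
      also have "cinner h (\<beta> *\<^sub>C g) = complex_of_real (((cmod \<beta>)\<^sup>2 * (norm g)\<^sup>2) / (s - t))"
        using complex_norm_square[of \<beta>]
        by (simp add: h_def cinner_algebra cinner_self scaleR_conv_of_real mult_ac)
      finally show ?thesis by simp
    qed
    moreover have "(cmod \<beta>)\<^sup>2 * (norm g)\<^sup>2 > 0" using b0 g0 by simp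
    ultimately show ?thesis by blast
  qed
  obtain \<gamma>1 w1 where g1: "\<gamma>1 > 0" "\<And>t. a < t \<Longrightarrow> t < c \<Longrightarrow> ?G v t = \<gamma>1 / (a - t) + ?G w1 t"
    using split[of a e] e by auto
  obtain \<gamma>2 w2 where g2: "\<gamma>2 > 0" "\<And>t. a < t \<Longrightarrow> t < c \<Longrightarrow> ?G v t = \<gamma>2 / (c - t) + ?G w2 t"
    using split[of c f] f by auto
  have mono: "?G w s \<le> ?G w t" if "a < s" "s \<le> t" "t < c" for w s t
    by (rule cinner_resolvent_mono[OF reg]) (use that in auto)
  \<comment> \<open>\<open>p\<close> lies so close to \<open>a\<close> that the pole term is at most
    \<open>- \<kappa>1\<close>, while monotonicity bounds the rest by its value at \<open>m\<close>,
    which is below \<open>\<kappa>1\<close>. The choice of \<open>q\<close> near \<open>c\<close>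
    mirrors this.\<close>
  define \<kappa>1 where "\<kappa>1 = 1 + \<bar>?G w1 m\<bar>"
  define p where "p = a + min (m - a) (\<gamma>1 / \<kappa>1)"
  have k1: "\<kappa>1 > 0" by (simp add: \<kappa>1_def)
  have p: "a < p" "p \<le> m" "(p - a) * \<kappa>1 \<le> \<gamma>1"
    using m g1 k1 by (auto simp: p_def min_def field_simps)
  have "?G v p \<le> 0"
  proof -
    have "\<kappa>1 \<le> \<gamma>1 / (p - a)" using p by (simp add: field_simps)
    moreover have "\<gamma>1 / (a - p) = - (\<gamma>1 / (p - a))" by (metis minus_diff_eq minus_divide_right)
    ultimately show ?thesis using g1(2)[of p] p m mono[of p m w1] by (simp add: \<kappa>1_def)
  qed
  define \<kappa>2 where "\<kappa>2 = 1 + \<bar>?G w2 m\<bar>"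
  define q where "q = c - min (c - m) (\<gamma>2 / \<kappa>2)"
  have k2: "\<kappa>2 > 0" by (simp add: \<kappa>2_def)
  have q: "q < c" "m \<le> q" "(c - q) * \<kappa>2 \<le> \<gamma>2"
    using m g2 k2 by (auto simp: q_def min_def field_simps)
  have "?G v q \<ge> 0"
  proof -
    have "\<kappa>2 \<le> \<gamma>2 / (c - q)" using q by (simp add: field_simps)
    then show ?thesis using g2(2)[of q] q m mono[of m q w2] by (simp add: \<kappa>2_def)
  qed
  with \<open>?G v p \<le> 0\<close> obtain t where t: "p \<le> t" "t \<le> q" "?G v t = 0"
    using IVT'[of "?G v" p 0 q] cinner_resolvent_continuous[OF reg, of a c p q v] p q by auto
  have rt: "regular t" using reg p q t by simp
  \<comment> \<open>The resolvent is symmetric, so the form is real and a zero of its real part is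
    enough.\<close>
  have "cinner (resolvent t v) v = cnj (cinner (resolvent t v) v)"
    by (metis cinner_commute resolvent_symmetric[OF rt])
  then have "Im (cinner (resolvent t v) v) = 0" by (simp add: complex_eq_iff)
  then show ?thesis using t p q by (intro exI[of _ t]) (simp add: complex_eq_iff)
qed

text \<open>
  By \<open>gap_cinner\<close> on both sides of \<open>a\<close>, polarized, \<open>\<delta> |Re \<langle>(H - a) x, y\<rangle>| \<le> \<parallel>(H - a) x\<parallel> \<parallel>(H - a) y\<parallel>\<close>.
  This makes \<open>\<epsilon> (H - a - \<epsilon>)\<^sup>-\<^sup>1 y\<close> Lipschitz in \<open>\<epsilon>\<close>; its limit \<open>P\<close> as \<open>\<epsilon> \<rightarrow> 0\<close> lies in the kernel of
  \<open>H - a\<close> and, if \<open>y\<close> is orthogonal to that kernel, so is \<open>P\<close>. Hence \<open>P = 0\<close>, the resolvents stay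
  bounded on such \<open>y\<close>, and they converge to a solution of \<open>(H - a) x = y\<close>.
\<close>

lemma inverse_at_eigenvalue:
  assumes "eigenvalue a"
  shows "\<exists>K. \<forall>y. (\<forall>z\<in>D. shift a z = 0 \<longrightarrow> cinner y z = 0) \<longrightarrow>
    (\<exists>x\<in>D. shift a x = y \<and> norm x \<le> K * norm y)"
proof -
  obtain \<delta> where d: "\<delta> > 0" "\<And>s. s \<noteq> a \<Longrightarrow> \<bar>s - a\<bar> < \<delta> \<Longrightarrow> regular s"
    using eigenvalue_isolated[OF assms] regularI by metis
  have quad: "\<delta> * \<bar>Re (cinner (shift a x) x)\<bar> \<le> (norm (shift a x))\<^sup>2" if x: "x \<in> D" for x
  proof -
    have 1: "0 \<le> Re (cinner (shift a x) (shift (a + \<delta>) x))"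
      using gap_cinner[of a 0 "a + \<delta>" x] d x by simp
    have 2: "0 \<le> Re (cinner (shift (a - \<delta>) x) (shift a x))"
      using gap_cinner[of "a - \<delta>" 0 a x] d x by simp
    have "shift (a + \<delta>) x = shift a x - \<delta> *\<^sub>R x" "shift (a - \<delta>) x = shift a x + \<delta> *\<^sub>R x"
      using shift_shift[of "a + \<delta>" x a] shift_shift[of "a - \<delta>" x a] by simp_all
    with 1 2 have "\<delta> * Re (cinner (shift a x) x) \<le> (norm (shift a x))\<^sup>2"
      "- (\<delta> * Re (cinner x (shift a x))) \<le> (norm (shift a x))\<^sup>2"
      by (simp_all add: cinner_algebra cinner_self)
    moreover have "\<delta> * \<bar>Re (cinner (shift a x) x)\<bar> = \<bar>\<delta> * Re (cinner (shift a x) x)\<bar>"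
      using d(1) by (simp add: abs_mult)
    ultimately show ?thesis unfolding Re_cinner_commute[of x "shift a x"] by linarith
  qed
  have form: "\<delta> * \<bar>Re (cinner (shift a x) y)\<bar> \<le> norm (shift a x) * norm (shift a y)"
    if x: "x \<in> D" and y: "y \<in> D" for x y
  proof -
    let ?X = "norm (shift a x)" and ?Y = "norm (shift a y)"
    show ?thesis
    proof (cases "?X * ?Y = 0")
      case True
      then have "cinner (shift a x) y = 0"
        using shift_symmetric[OF x y, of a] by (auto simp: cinner.zero_left cinner.zero_right)
      then show ?thesis by simp
    next
      case False
      then have pos: "?X * ?Y > 0" by simp
      \<comment> \<open>Scaling each vector by the norm of the other's image gives both images the
        norm \<open>?X * ?Y\<close>. Polarization and the parallelogram law then yield a product of
        norms instead of a sum of squares.\<close>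
      define u where "u = ?Y *\<^sub>R x"
      define v where "v = ?X *\<^sub>R y"
      have uv: "u \<in> D" "v \<in> D" by (simp_all add: u_def v_def H_scaleR x y)
      have nu: "norm (shift a u) = ?X * ?Y" "norm (shift a v) = ?X * ?Y"
        by (simp_all add: u_def v_def shift_scaleR x y)
      have sym: "Re (cinner (shift a v) u) = Re (cinner (shift a u) v)"
        using shift_symmetric[OF uv(2,1), of a] by (simp add: Re_cinner_commute)
      have "4 * Re (cinner (shift a u) v)
          = Re (cinner (shift a (u + v)) (u + v)) - Re (cinner (shift a (u - v)) (u - v))"
        using sym by (simp add: shift_add shift_diff uv cinner_algebra)
      then have "4 * (\<delta> * \<bar>Re (cinner (shift a u) v)\<bar>)
          \<le> \<delta> * \<bar>Re (cinner (shift a (u + v)) (u + v))\<bar> + \<delta> * \<bar>Re (cinner (shift a (u - v)) (u - v))\<bar>"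
        using d(1) by (simp add: distrib_left[symmetric] mult.left_commute[of 4])
      also have "\<dots> \<le> (norm (shift a (u + v)))\<^sup>2 + (norm (shift a (u - v)))\<^sup>2"
        using uv by (intro add_mono quad) (auto simp: H_add H_diff)
      also have "\<dots> = 4 * (?X * ?Y)\<^sup>2"
        by (simp add: shift_add shift_diff uv power2_norm_add power2_norm_diff nu)
      finally have "\<delta> * \<bar>Re (cinner (shift a u) v)\<bar> \<le> (?X * ?Y)\<^sup>2" by simp
      moreover have "Re (cinner (shift a u) v) = (?X * ?Y) * Re (cinner (shift a x) y)"
        by (simp add: u_def v_def shift_scaleR x cinner_algebra)
      ultimately have "(?X * ?Y) * (\<delta> * \<bar>Re (cinner (shift a x) y)\<bar>) \<le> (?X * ?Y) * (?X * ?Y)"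
        using pos by (simp add: abs_mult power2_eq_square mult_ac)
      then show ?thesis using pos by (simp only: mult_le_cancel_left_pos)
    qed
  qed
  \<comment> \<open>The factor 1/2 keeps the open ball of radius \<open>\<epsilon> n\<close> about
    \<open>a + \<epsilon> n\<close> strictly between \<open>a\<close> and
    \<open>a + \<delta>\<close>, so \<open>gap_resolvent\<close> gives the bound
    \<open>1 / \<epsilon> n\<close>.\<close>
  define \<epsilon> where "\<epsilon> n = \<delta> / 2 * inverse (real (Suc n))" for n
  have eps0: "\<epsilon> \<longlonglongrightarrow> 0"
    unfolding \<epsilon>_def using tendsto_mult_left[OF LIMSEQ_inverse_real_of_nat, of "\<delta> / 2"] by simp
  have eps: "0 < \<epsilon> n" "2 * \<epsilon> n \<le> \<delta>" for n
    using d(1) by (auto simp: \<epsilon>_def field_simps)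
  let ?R = "\<lambda>n. resolvent (a + \<epsilon> n)"
  have reg: "regular (a + \<epsilon> n)" for n
    using d(2)[of "a + \<epsilon> n"] eps[of n] d(1) by simp
  have RD: "?R n v \<in> D" for n v by (rule resolvent_in[OF reg])
  have Rnorm: "norm (?R n v) \<le> norm v / \<epsilon> n" for n v
    by (rule gap_resolvent) (use eps[of n] in \<open>auto intro!: d(2)\<close>)
  have HR: "shift a (?R n v) = v + \<epsilon> n *\<^sub>R ?R n v" for n v
    using shift_shift[of a "?R n v" "a + \<epsilon> n"] by (simp add: shift_resolvent[OF reg])
  have HRnorm: "norm (shift a (?R n v)) \<le> 2 * norm v" for n v
  proof -
    have "norm (shift a (?R n v)) \<le> norm v + \<epsilon> n * norm (?R n v)"
      using norm_triangle_ineq[of v "\<epsilon> n *\<^sub>R ?R n v"] eps(1)[of n] by (simp add: HR)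
    also have "\<epsilon> n * norm (?R n v) \<le> norm v" using Rnorm[of n v] eps(1)[of n] by (simp add: field_simps)
    finally show ?thesis by simp
  qed
  have Rdiff: "?R n v - ?R m v = (\<epsilon> n - \<epsilon> m) *\<^sub>R ?R n (?R m v)" for n m v
    using resolvent_diff[OF reg reg, of n v m] by simp
  have eRdiff: "norm (\<epsilon> n *\<^sub>R ?R n y - \<epsilon> m *\<^sub>R ?R m y) \<le> (4 / \<delta> * norm y) * \<bar>\<epsilon> n - \<epsilon> m\<bar>" for n m y
  proof -
    have eq: "\<epsilon> n *\<^sub>R ?R n y - \<epsilon> m *\<^sub>R ?R m y = (\<epsilon> n - \<epsilon> m) *\<^sub>R shift a (?R n (?R m y))"
    proof -
      have "(\<epsilon> n - \<epsilon> m) *\<^sub>R shift a (?R n (?R m y))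
          = (\<epsilon> n - \<epsilon> m) *\<^sub>R ?R m y + \<epsilon> n *\<^sub>R (?R n y - ?R m y)"
        by (simp add: HR Rdiff algebra_simps)
      then show ?thesis by (simp add: algebra_simps)
    qed
    \<comment> \<open>The bound is uniform although both resolvents may blow up:
      \<open>H - a\<close> and \<open>?R n\<close> move to the test vector, and \<open>form\<close>
      distributes one factor \<open>H - a\<close> to each resolvent.\<close>
    have "norm (shift a (?R n (?R m y))) \<le> 4 / \<delta> * norm y"
    proof (rule norm_le_of_cinner_bound)
      fix v
      have "cinner (shift a (?R n (?R m y))) v = cinner (?R m y) (shift a (?R n v))"
        by (simp add: HR cinner_algebra resolvent_symmetric[OF reg])
      then have "Re (cinner (shift a (?R n (?R m y))) v) = Re (cinner (shift a (?R n v)) (?R m y))"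
        by (simp add: Re_cinner_commute)
      then have "\<delta> * Re (cinner (shift a (?R n (?R m y))) v) \<le> \<delta> * \<bar>Re (cinner (shift a (?R n v)) (?R m y))\<bar>"
        using d(1) by simp
      also have "\<dots> \<le> norm (shift a (?R n v)) * norm (shift a (?R m y))" by (rule form[OF RD RD])
      also have "\<dots> \<le> (2 * norm v) * (2 * norm y)" by (intro mult_mono HRnorm) auto
      finally show "Re (cinner (shift a (?R n (?R m y))) v) \<le> 4 / \<delta> * norm y * norm v"
        using d(1) by (simp add: field_simps)
    qed (use d(1) in simp)
    from mult_left_mono[OF this, of "\<bar>\<epsilon> n - \<epsilon> m\<bar>"] show ?thesis
      unfolding eq by (simp add: mult_ac)
  qed
  have conv: "convergent X" if X: "\<And>n m. norm (X n - X m) \<le> K * \<bar>\<epsilon> n - \<epsilon> m\<bar>" and K: "K \<ge> 0"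
    for X :: "nat \<Rightarrow> 'a" and K
  proof -
    have "Cauchy X"
    proof (rule metric_CauchyI)
      fix e :: real assume e: "e > 0"
      have "Cauchy \<epsilon>" using eps0 by (rule LIMSEQ_imp_Cauchy)
      from metric_CauchyD[OF this, of "e / (K + 1)"] e K
      obtain M where M: "\<And>m n. m \<ge> M \<Longrightarrow> n \<ge> M \<Longrightarrow> dist (\<epsilon> m) (\<epsilon> n) < e / (K + 1)" by auto
      have "dist (X m) (X n) < e" if "m \<ge> M" "n \<ge> M" for m n
      proof -
        have "dist (X m) (X n) \<le> K * \<bar>\<epsilon> m - \<epsilon> n\<bar>" using X by (simp add: dist_norm)
        also have "\<dots> \<le> (K + 1) * \<bar>\<epsilon> m - \<epsilon> n\<bar>" by (simp add: mult_right_mono)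
        also have "\<dots> < e" using M[OF that] K by (simp add: dist_real_def field_simps)
        finally show ?thesis .
      qed
      then show "\<exists>M. \<forall>m\<ge>M. \<forall>n\<ge>M. dist (X m) (X n) < e" by blast
    qed
    then show ?thesis by (simp add: Cauchy_convergent_iff)
  qed
  define M where "M = {y. \<forall>z\<in>D. shift a z = 0 \<longrightarrow> cinner y z = 0}"
  \<comment> \<open>Kernel vectors are eigenvectors of the resolvents, so these, being symmetric,
    leave the orthogonal complement \<open>M\<close> of the kernel invariant.\<close>
  have Rker: "?R n z = (- 1 / \<epsilon> n) *\<^sub>R z" if "z \<in> D" "shift a z = 0" for n z
  proof (rule resolvent_eqI[OF reg])
    show "(- 1 / \<epsilon> n) *\<^sub>R z \<in> D" using H_scaleR[OF that(1)] by blast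
    show "shift (a + \<epsilon> n) ((- 1 / \<epsilon> n) *\<^sub>R z) = z"
      using shift_shift[of "a + \<epsilon> n" z a] that eps(1)[of n]
      by (simp only: shift_scaleR) simp
  qed
  have RM: "?R n y \<in> M" if "y \<in> M" for n y
    using that by (auto simp: M_def resolvent_symmetric[OF reg] Rker cinner_algebra)
  have Rbound: "norm (?R n y) \<le> 4 / \<delta> * norm y" if y: "y \<in> M" for n y
  proof -
    have "convergent (\<lambda>n. \<epsilon> n *\<^sub>R ?R n y)"
      using conv[of "\<lambda>n. \<epsilon> n *\<^sub>R ?R n y", OF eRdiff] d(1) by simp
    then obtain P where P: "(\<lambda>n. \<epsilon> n *\<^sub>R ?R n y) \<longlonglongrightarrow> P" by (auto simp: convergent_def)
    have "(\<lambda>n. \<epsilon> n *\<^sub>R (y + \<epsilon> n *\<^sub>R ?R n y)) \<longlonglongrightarrow> 0 *\<^sub>R (y + P)"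
      by (intro tendsto_intros eps0 P)
    then have "(\<lambda>n. \<epsilon> n *\<^sub>R shift a (?R n y)) \<longlonglongrightarrow> 0" by (simp add: HR)
    then have "(\<lambda>n. shift a (\<epsilon> n *\<^sub>R ?R n y)) \<longlonglongrightarrow> 0" by (simp add: shift_scaleR RD)
    from tendsto_add[OF this tendsto_scaleR[OF tendsto_const[of a] P]]
    have "(\<lambda>n. H (\<epsilon> n *\<^sub>R ?R n y)) \<longlonglongrightarrow> a *\<^sub>R P" by (simp add: shift_def)
    with H_closed[OF _ P this] have PD: "P \<in> D" "shift a P = 0"
      by (simp_all add: H_scaleR RD shift_def)
    have "cinner (\<epsilon> n *\<^sub>R ?R n y) P = 0" for n
      using RM[OF y] PD by (simp add: M_def cinner_algebra)
    with cinner.tendsto[OF P tendsto_const[of P]] have "cinner P P = 0"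
      using LIMSEQ_unique by (simp add: LIMSEQ_const_iff)
    then have P0: "P = 0" by (simp add: cinner_self)
    \<comment> \<open>Letting \<open>m\<close> tend to infinity in \<open>eRdiff\<close>, with
      \<open>P = 0\<close>, leaves a factor \<open>\<epsilon> n\<close> on both sides. Cancelling it
      gives a bound uniform in \<open>n\<close>.\<close>
    have "(\<lambda>m. norm (\<epsilon> n *\<^sub>R ?R n y - \<epsilon> m *\<^sub>R ?R m y)) \<longlonglongrightarrow> norm (\<epsilon> n *\<^sub>R ?R n y - P)"
      by (intro tendsto_intros P)
    moreover have "(\<lambda>m. (4 / \<delta> * norm y) * \<bar>\<epsilon> n - \<epsilon> m\<bar>) \<longlonglongrightarrow> (4 / \<delta> * norm y) * \<bar>\<epsilon> n - 0\<bar>"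
      by (intro tendsto_intros eps0)
    ultimately have "norm (\<epsilon> n *\<^sub>R ?R n y - P) \<le> (4 / \<delta> * norm y) * \<bar>\<epsilon> n - 0\<bar>"
      by (rule LIMSEQ_le) (use eRdiff in blast)
    then have "\<epsilon> n * norm (?R n y) \<le> \<epsilon> n * (4 / \<delta> * norm y)"
      using P0 eps(1)[of n] by (simp add: mult_ac)
    then show ?thesis using eps(1)[of n] by (simp only: mult_le_cancel_left_pos)
  qed
  show ?thesis
  proof (intro exI[of _ "4 / \<delta>"] allI impI)
    fix y assume "\<forall>z\<in>D. shift a z = 0 \<longrightarrow> cinner y z = 0"
    then have y: "y \<in> M" by (simp add: M_def)
    have "norm (?R n y - ?R m y) \<le> (4 / \<delta> * (4 / \<delta> * norm y)) * \<bar>\<epsilon> n - \<epsilon> m\<bar>" for n m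
    proof -
      have "norm (?R n (?R m y)) \<le> 4 / \<delta> * norm (?R m y)" by (rule Rbound[OF RM[OF y]])
      also have "\<dots> \<le> 4 / \<delta> * (4 / \<delta> * norm y)"
        using Rbound[OF y, of m] d(1) by (intro mult_left_mono) auto
      finally have "norm (?R n (?R m y)) \<le> 4 / \<delta> * (4 / \<delta> * norm y)" .
      from mult_left_mono[OF this, of "\<bar>\<epsilon> n - \<epsilon> m\<bar>"] show ?thesis
        unfolding Rdiff by (simp add: mult_ac)
    qed
    from conv[of "\<lambda>n. ?R n y", OF this] have "convergent (\<lambda>n. ?R n y)" using d(1) by simp
    then obtain x where x: "(\<lambda>n. ?R n y) \<longlonglongrightarrow> x" by (auto simp: convergent_def)
    have "(\<lambda>n. (y + \<epsilon> n *\<^sub>R ?R n y) + a *\<^sub>R ?R n y) \<longlonglongrightarrow> (y + 0 *\<^sub>R x) + a *\<^sub>R x"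
      by (intro tendsto_intros eps0 x)
    then have "(\<lambda>n. H (?R n y)) \<longlonglongrightarrow> y + a *\<^sub>R x"
      unfolding HR[symmetric] by (simp add: shift_def)
    with H_closed[OF _ x this] have "x \<in> D" "shift a x = y" by (simp_all add: RD shift_def)
    moreover have "norm x \<le> 4 / \<delta> * norm y"
      by (rule LIMSEQ_le_const2[OF tendsto_norm[OF x]]) (use Rbound[OF y] in blast)
    ultimately show "\<exists>x\<in>D. shift a x = y \<and> norm x \<le> 4 / \<delta> * norm y" by blast
  qed
qed

end

section \<open>Skew-adjoint operators\<close>

locale skew_adjoint =
  fixes D :: "'a::chilbert_space set" and A :: "'a \<Rightarrow> 'a"
  assumes skew_graph: "adjoint_graph D A = graph_on D (\<lambda>x. - A x)"
begin

definition H :: "'a \<Rightarrow> 'a"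
  where "H x = (- \<i>) *\<^sub>C A x"

sublocale selfadjoint D H
proof
  have 1: "(y, z) \<in> adjoint_graph D H \<longleftrightarrow> (y, (- \<i>) *\<^sub>C z) \<in> adjoint_graph D A" for y z
  proof -
    have "- (\<i> * p) = q \<longleftrightarrow> p = \<i> * q" for p q :: complex
      by (auto simp: mult.assoc[symmetric])
    then show ?thesis by (simp add: adjoint_graph_def H_def cinner_algebra)
  qed
  have 2: "(- \<i>) *\<^sub>C z = - A y \<longleftrightarrow> z = H y" for z y
  proof
    assume "(- \<i>) *\<^sub>C z = - A y"
    then have "\<i> *\<^sub>C (- \<i>) *\<^sub>C z = \<i> *\<^sub>C (- A y)" by simp
    then show "z = H y" by (simp add: H_def scaleC_scaleC scaleC.minus_left scaleC.minus_right)
  next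
    assume "z = H y"
    then show "(- \<i>) *\<^sub>C z = - A y"
      by (simp add: H_def scaleC_scaleC scaleC.minus_left scaleC.minus_right)
  qed
  show "adjoint_graph D H = graph_on D H"
  proof (rule set_eqI, clarify)
    fix y z
    show "(y, z) \<in> adjoint_graph D H \<longleftrightarrow> (y, z) \<in> graph_on D H"
      unfolding 1 skew_graph using 2 by (auto simp: graph_on_def)
  qed
qed

lemma A_conv: "A x = \<i> *\<^sub>C H x"
  by (simp add: H_def scaleC_scaleC)

lemma A_add:
  assumes "x \<in> D" "y \<in> D"
  shows "A (x + y) = A x + A y"
  by (subst (1 2 3) A_conv) (simp only: H_add[OF assms] scaleC.add_right)

lemma A_scaleC:
  assumes "x \<in> D"
  shows "A (a *\<^sub>C x) = a *\<^sub>C A x"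
  by (subst (1 2) A_conv) (simp only: H_scaleC[OF assms] scaleC_scaleC mult_ac)

lemma A_skew:
  assumes "x \<in> D" "y \<in> D"
  shows "cinner (A x) y = - cinner x (A y)"
proof -
  have "(y, - A y) \<in> adjoint_graph D A"
    using assms by (simp add: skew_graph graph_on_def)
  then show ?thesis using assms by (simp add: adjoint_graph_def cinner.minus_right)
qed

lemma Re_cinner_A:
  assumes "x \<in> D"
  shows "Re (cinner (A x) x) = 0"
  using A_skew[OF assms assms] Re_cinner_commute[of "A x" x] by simp

lemma shift_conv: "shift t x = \<i> *\<^sub>C ((\<i> * complex_of_real t) *\<^sub>C x - A x)"
  by (simp add: shift_def H_def scaleC.diff_right scaleC_scaleC scaleC.minus_left scaleR_scaleC
      mult.assoc[symmetric])

lemma conv_shift: "(\<i> * complex_of_real t) *\<^sub>C x - A x = (- \<i>) *\<^sub>C shift t x"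
  by (simp add: shift_conv scaleC_scaleC)

lemma shift_eq_0_iff: "shift t x = 0 \<longleftrightarrow> A x = (\<i> * complex_of_real t) *\<^sub>C x"
  using conv_shift[of t x] shift_conv[of t x] by (auto simp: scaleC.zero_right)

lemma eigenvalue_iff: "eigenvalue t \<longleftrightarrow> \<i> * complex_of_real t \<in> eigenvalues D A"
  by (auto simp: eigenvalue_def eigenvalues_def shift_eq_0_iff)

lemma Re_eigenvalue:
  assumes "s \<in> eigenvalues D A"
  shows "Re s = 0"
proof -
  obtain x where x: "x \<in> D" "x \<noteq> 0" "A x = s *\<^sub>C x" using assms by (auto simp: eigenvalues_def)
  then have "Re s * (norm x)\<^sup>2 = 0"
    using Re_cinner_A[OF x(1)] by (simp add: cinner_scaleC_left cinner_self)
  then show ?thesis using x by simp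
qed

lemma eigenvalues_subset_spectrum: "eigenvalues D A \<subseteq> spectrum D A"
proof
  fix s assume "s \<in> eigenvalues D A"
  then obtain x where x: "x \<in> D" "x \<noteq> 0" "A x = s *\<^sub>C x" by (auto simp: eigenvalues_def)
  have "0 \<in> D" "A 0 = 0"
    using H_scaleC[OF x(1), of 0] A_scaleC[OF x(1), of 0] by (simp_all add: scaleC.zero_left)
  then have "\<not> inj_on (\<lambda>x. s *\<^sub>C x - A x) D"
    using x inj_onD[of "\<lambda>x. s *\<^sub>C x - A x" D x 0] by (auto simp: scaleC.zero_right)
  then show "s \<in> spectrum D A" by (auto simp: spectrum_def resolvent_set_def bij_betw_def)
qed

end

section \<open>Resolvent sets through solvability with an estimate\<close>

lemma resolvent_setE:
  assumes "s \<in> resolvent_set D A"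
  obtains R where "bounded_clinear R" "\<And>v. R v \<in> D" "\<And>v. s *\<^sub>C R v - A (R v) = v"
    "\<And>x. x \<in> D \<Longrightarrow> R (s *\<^sub>C x - A x) = x"
proof
  let ?R = "inv_into D (\<lambda>x. s *\<^sub>C x - A x)"
  have bij: "bij_betw (\<lambda>x. s *\<^sub>C x - A x) D UNIV" and "bounded_clinear ?R"
    using assms by (auto simp: resolvent_set_def)
  show "bounded_clinear ?R" by fact
  show "?R v \<in> D" "s *\<^sub>C ?R v - A (?R v) = v" for v
    using inv_into_into[of v "\<lambda>x. s *\<^sub>C x - A x" D] f_inv_into_f[of v "\<lambda>x. s *\<^sub>C x - A x" D] bij
    by (simp_all add: bij_betw_def)
  show "?R (s *\<^sub>C x - A x) = x" if "x \<in> D" for x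
    using bij_betw_inv_into_left[OF bij that] by simp
qed

text \<open>A trivial kernel makes solutions unique, so the solution with the estimate is the value
  of \<open>inv_into\<close>, which thereby inherits the bound; its linearity comes from that of
  \<open>A\<close>.\<close>

lemma resolvent_setI:
  fixes A :: "'a::chilbert_space \<Rightarrow> 'a"
  assumes add: "\<And>x y. x \<in> D \<Longrightarrow> y \<in> D \<Longrightarrow> x + y \<in> D \<and> A (x + y) = A x + A y"
    and scale: "\<And>a x. x \<in> D \<Longrightarrow> a *\<^sub>C x \<in> D \<and> A (a *\<^sub>C x) = a *\<^sub>C A x"
    and inj: "\<And>x. x \<in> D \<Longrightarrow> s *\<^sub>C x - A x = 0 \<Longrightarrow> x = 0"
    and surj: "\<And>v. \<exists>x\<in>D. s *\<^sub>C x - A x = v \<and> norm x \<le> K * norm v"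
  shows "s \<in> resolvent_set D A"
proof -
  define T where "T x = s *\<^sub>C x - A x" for x
  let ?R = "inv_into D T"
  have Tadd: "T (x + y) = T x + T y" if "x \<in> D" "y \<in> D" for x y
    using that by (simp add: T_def add scaleC_add_right)
  have Tscale: "T (a *\<^sub>C x) = a *\<^sub>C T x" if "x \<in> D" for a x
    using that by (simp add: T_def scale scaleC_scaleC scaleC.diff_right mult.commute)
  have bij: "bij_betw T D UNIV"
    unfolding bij_betw_def
  proof
    show "inj_on T D"
    proof (rule inj_onI)
      fix x y assume xy: "x \<in> D" "y \<in> D" "T x = T y"
      have "x + (- 1) *\<^sub>C y \<in> D" using xy add scale by blast
      moreover have "T (x + (- 1) *\<^sub>C y) = 0"
        using xy scale[of y "- 1"] Tadd[of x "(- 1) *\<^sub>C y"] Tscale[of y "- 1"]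
        by (simp add: scaleC.minus_left)
      ultimately have "x + (- 1) *\<^sub>C y = 0" using inj unfolding T_def by blast
      then show "x = y" by (simp add: scaleC.minus_left)
    qed
    show "T ` D = UNIV" using surj by (auto simp: T_def image_iff) metis
  qed
  have left: "?R (T x) = x" if "x \<in> D" for x by (rule bij_betw_inv_into_left[OF bij that])
  have RT: "?R v \<in> D \<and> T (?R v) = v" for v
    using bij by (metis UNIV_I bij_betw_def f_inv_into_f inv_into_into)
  have Rscale: "?R (a *\<^sub>C v) = a *\<^sub>C ?R v" for a v
    using left[of "a *\<^sub>C ?R v"] RT[of v] scale[of "?R v" a] Tscale[of "?R v" a] by simp
  have "bounded_linear ?R"
  proof (rule bounded_linear_intro)
    show "?R (v + w) = ?R v + ?R w" for v w
      using left[of "?R v + ?R w"] RT[of v] RT[of w] add[of "?R v" "?R w"] Tadd[of "?R v" "?R w"]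
      by simp
    show "?R (r *\<^sub>R v) = r *\<^sub>R ?R v" for r v by (simp add: scaleR_scaleC Rscale)
    show "norm (?R v) \<le> norm v * K" for v
    proof -
      obtain x where "x \<in> D" "T x = v" "norm x \<le> K * norm v" using surj[of v] by (auto simp: T_def)
      then show ?thesis using left[of x] by (simp add: mult.commute)
    qed
  qed
  with Rscale have "bounded_clinear ?R" by (simp add: bounded_clinear_def)
  with bij show ?thesis unfolding resolvent_set_def T_def by simp
qed

section \<open>Minimal collocated systems: zeros and interlacing\<close>

locale collocated = skew_adjoint +
  fixes b :: 'a
  assumes b_nonzero: "b \<noteq> 0"
    and spectrum_subset: "spectrum D A \<subseteq> eigenvalues D A"
    and spectrum_isolated: "s \<in> spectrum D A \<Longrightarrow> s isolated_in spectrum D A"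
    and minimal: "invariant_zeros D A (\<lambda>u. u *\<^sub>C b) (\<lambda>x. cinner x b) \<inter> spectrum D A = {}"
begin

abbreviation zeros :: "complex set"
  where "zeros \<equiv> invariant_zeros D A (\<lambda>u. u *\<^sub>C b) (\<lambda>x. cinner x b)"

abbreviation loop :: "real \<Rightarrow> 'a \<Rightarrow> 'a"
  where "loop k \<equiv> closed_loop A (\<lambda>u. u *\<^sub>C b) (\<lambda>x. cinner x b) k"

sublocale discrete_selfadjoint D H
proof
  fix t
  show "regular t" if "\<not> eigenvalue t"
  proof -
    have "\<i> * complex_of_real t \<in> resolvent_set D A"
      using that spectrum_subset by (auto simp: eigenvalue_iff spectrum_def)
    then obtain R where R: "bounded_clinear R" "\<And>v. R v \<in> D"
      "\<And>v. (\<i> * complex_of_real t) *\<^sub>C R v - A (R v) = v"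
      "\<And>x. x \<in> D \<Longrightarrow> R ((\<i> * complex_of_real t) *\<^sub>C x - A x) = x"
      by (rule resolvent_setE) blast
    obtain K where K: "K > 0" "\<And>v. norm (R v) \<le> norm v * K"
      using bounded_linear.pos_bounded[of R] R(1) by (auto simp: bounded_clinear_def)
    have "\<exists>x\<in>D. shift t x = v" for v
      by (rule bexI[OF _ R(2)[of "(- \<i>) *\<^sub>C v"]]) (simp add: shift_conv R(3) scaleC_scaleC)
    moreover have "1 / K * norm x \<le> norm (shift t x)" if "x \<in> D" for x
    proof -
      have "norm (shift t x) = norm ((\<i> * complex_of_real t) *\<^sub>C x - A x)"
        unfolding shift_conv norm_scaleC by simp
      then show ?thesis
        using K(2)[of "(\<i> * complex_of_real t) *\<^sub>C x - A x"] K(1) that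
        by (simp add: R(4) field_simps)
    qed
    ultimately show ?thesis unfolding regular_def using K(1) by (metis zero_less_divide_1_iff)
  qed
  show "\<exists>\<delta>>0. \<forall>s. s \<noteq> t \<longrightarrow> \<bar>s - t\<bar> < \<delta> \<longrightarrow> \<not> eigenvalue s" if "eigenvalue t"
  proof -
    have "\<i> * complex_of_real t isolated_in spectrum D A"
      using that eigenvalues_subset_spectrum by (intro spectrum_isolated) (auto simp: eigenvalue_iff)
    then obtain T where T: "open T" "T \<inter> spectrum D A = {\<i> * complex_of_real t}"
      by (auto simp: isolated_in_def)
    then obtain \<delta> where d: "\<delta> > 0" "ball (\<i> * complex_of_real t) \<delta> \<subseteq> T"
      by (metis Int_iff insertI1 open_contains_ball)
    have "\<not> eigenvalue s" if "s \<noteq> t" "\<bar>s - t\<bar> < \<delta>" for s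
    proof
      assume "eigenvalue s"
      then have "\<i> * complex_of_real s \<in> spectrum D A"
        using eigenvalues_subset_spectrum by (auto simp: eigenvalue_iff)
      moreover have "dist (\<i> * complex_of_real t) (\<i> * complex_of_real s) = \<bar>t - s\<bar>"
        by (simp add: dist_norm norm_mult flip: right_diff_distrib of_real_diff)
      then have "\<i> * complex_of_real s \<in> T" using d that by (auto simp: abs_minus_commute)
      ultimately have "\<i> * complex_of_real s \<in> {\<i> * complex_of_real t}" using T by blast
      then show False using that by simp
    qed
    then show ?thesis using d by blast
  qed
qed

text \<open>This is how minimality enters: an eigenvector orthogonal to \<open>b\<close> would
  exhibit its eigenvalue as an invariant zero with input \<open>u = 0\<close>.\<close>

lemma kernel_orthogonal:
  assumes "x \<in> D" "A x = s *\<^sub>C x" "cinner x b = 0"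
  shows "x = 0"
proof (rule ccontr)
  assume "x \<noteq> 0"
  then have "s \<in> eigenvalues D A" using assms by (auto simp: eigenvalues_def)
  moreover have "s \<in> zeros"
    using assms \<open>x \<noteq> 0\<close>
    by (auto simp: invariant_zeros_def scaleC.zero_left intro!: bexI[of _ x] exI[of _ 0])
  ultimately show False using minimal eigenvalues_subset_spectrum by blast
qed

text \<open>Pairing the zero equation with \<open>x\<close> removes the input term, because
  \<open>x\<close> is orthogonal to \<open>b\<close>, and skew-adjointness removes \<open>A\<close>
  from the real part.\<close>

lemma Re_zero:
  assumes "s \<in> zeros"
  shows "Re s = 0"
proof -
  obtain x u where x: "x \<in> D" "x \<noteq> 0" "s *\<^sub>C x - A x = u *\<^sub>C b" "cinner x b = 0"
    using assms by (auto simp: invariant_zeros_def)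
  have "cinner b x = 0" using x(4) cinner_commute[of b x] by simp
  then have "cinner (s *\<^sub>C x - A x) x = 0" unfolding x(3) by (simp add: cinner_scaleC_left)
  then have "Re (cinner (s *\<^sub>C x - A x) x) = 0" by simp
  then show ?thesis
    using x(1,2) by (simp add: cinner_algebra cinner_self Re_cinner_A)
qed

text \<open>At a regular \<open>t\<close> the transfer function at \<open>\<i> * t\<close> is
  \<open>\<i> * cinner (resolvent t b) b\<close>. Minimality places every zero on the imaginary axis
  at a regular \<open>t\<close>, where its vector must be a multiple of
  \<open>resolvent t b\<close>.\<close>

lemma zeros_iff:
  "\<i> * complex_of_real t \<in> zeros \<longleftrightarrow> regular t \<and> cinner (resolvent t b) b = 0"
proof
  assume z: "\<i> * complex_of_real t \<in> zeros"
  then have t: "regular t"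
    using minimal eigenvalues_subset_spectrum by (intro regularI) (auto simp: eigenvalue_iff)
  obtain x u where x: "x \<in> D" "x \<noteq> 0" "(\<i> * complex_of_real t) *\<^sub>C x - A x = u *\<^sub>C b" "cinner x b = 0"
    using z by (auto simp: invariant_zeros_def)
  have sx: "shift t x = (\<i> * u) *\<^sub>C b" by (simp add: shift_conv x(3) scaleC_scaleC)
  have "u \<noteq> 0"
    using regular_not_eigenvalue[OF t] x sx by (auto simp: eigenvalue_def scaleC.zero_left)
  then have "resolvent t b = (1 / (\<i> * u)) *\<^sub>C x"
    using x by (intro resolvent_eqI[OF t]) (simp_all add: H_scaleC shift_scaleC sx scaleC_scaleC)
  with t x show "regular t \<and> cinner (resolvent t b) b = 0" by (simp add: cinner_scaleC_left)
next
  assume t: "regular t \<and> cinner (resolvent t b) b = 0"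
  have "(\<i> * complex_of_real t) *\<^sub>C resolvent t b - A (resolvent t b) - (- \<i>) *\<^sub>C b = 0"
    using t by (simp add: conv_shift shift_resolvent)
  moreover have "resolvent t b \<noteq> 0"
    using shift_resolvent[of t b] shift_scaleR[OF resolvent_in[of t b], of t 0] t b_nonzero by auto
  ultimately show "\<i> * complex_of_real t \<in> zeros"
    unfolding invariant_zeros_def using t resolvent_in[of t b] by blast
qed

lemma Im_zeros_iff: "t \<in> Im ` zeros \<longleftrightarrow> regular t \<and> cinner (resolvent t b) b = 0"
proof -
  have "t \<in> Im ` zeros \<longleftrightarrow> \<i> * complex_of_real t \<in> zeros"
  proof
    assume "t \<in> Im ` zeros"
    then obtain s where s: "s \<in> zeros" "t = Im s" by auto
    then have "\<i> * complex_of_real t = s" using Re_zero by (simp add: complex_eq_iff)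
    with s show "\<i> * complex_of_real t \<in> zeros" by simp
  qed (force intro: image_eqI[of _ Im])
  then show ?thesis by (simp add: zeros_iff)
qed

lemma Im_eigenvalues_iff: "t \<in> Im ` eigenvalues D A \<longleftrightarrow> eigenvalue t"
proof
  assume "t \<in> Im ` eigenvalues D A"
  then obtain s where s: "s \<in> eigenvalues D A" "t = Im s" by auto
  then have "\<i> * complex_of_real t = s" using Re_eigenvalue by (simp add: complex_eq_iff)
  with s show "eigenvalue t" by (simp add: eigenvalue_iff)
qed (force simp: eigenvalue_iff intro: image_eqI[of _ Im])

lemma zeros_eigenvalues_interlace: "interlace (Im ` zeros) (Im ` eigenvalues D A)"
  unfolding interlace_def
proof (intro conjI ballI impI)
  show "Im ` zeros \<inter> Im ` eigenvalues D A = {}"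
    using regular_not_eigenvalue unfolding disjoint_iff Im_zeros_iff Im_eigenvalues_iff by blast
next
  fix x y assume xy: "x \<in> Im ` zeros" "y \<in> Im ` zeros" "x < y"
  show "\<exists>t\<in>Im ` eigenvalues D A. x < t \<and> t < y"
  proof (rule ccontr)
    assume *: "\<not> ?thesis"
    have "regular s" if "x \<le> s" "s \<le> y" for s
    proof (cases "s = x \<or> s = y")
      case True
      then show ?thesis using xy by (auto simp: Im_zeros_iff simp del: image_iff)
    next
      case False
      then have "s \<notin> Im ` eigenvalues D A" using * that by force
      then show ?thesis using regularI by (simp only: Im_eigenvalues_iff)
    qed
    from cinner_resolvent_strict_mono[OF this xy(3) b_nonzero] xy
    show False by (simp add: Im_zeros_iff)
  qed
next
  fix x y assume "x \<in> Im ` eigenvalues D A" "y \<in> Im ` eigenvalues D A" "x < y"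
  then have "eigenvalue x" "eigenvalue y" "x < y" by (simp_all only: Im_eigenvalues_iff)
  \<comment> \<open>The eigenvalue \<open>y\<close> may not be the one following \<open>x\<close>,
    so the zero is sought before the next eigenvalue \<open>c\<close>.\<close>
  then obtain c where c: "x < c" "c \<le> y" "eigenvalue c" "\<And>s. x < s \<Longrightarrow> s < c \<Longrightarrow> regular s"
    using next_eigenvalue[of x y] by blast
  \<comment> \<open>By minimality the poles at both ends are genuine.\<close>
  have ev: "\<exists>e\<in>D. shift s e = 0 \<and> cinner e b \<noteq> 0" if "eigenvalue s" for s
    using that kernel_orthogonal by (fastforce simp: eigenvalue_def shift_eq_0_iff)
  obtain t where "x < t" "t < c" "cinner (resolvent t b) b = 0"
    using cinner_resolvent_zero[OF c(4,1)] ev[OF \<open>eigenvalue x\<close>] ev[OF c(3)] by blast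
  then show "\<exists>s\<in>Im ` zeros. x < s \<and> s < y"
    using c by (intro bexI[of _ t]) (auto simp: Im_zeros_iff simp del: image_iff)
qed

section \<open>The closed-loop operator\<close>

lemma loop_add: "x \<in> D \<Longrightarrow> y \<in> D \<Longrightarrow> x + y \<in> D \<and> loop k (x + y) = loop k x + loop k y"
  by (simp add: closed_loop_def A_add H_add cinner_algebra scaleC_add_left algebra_simps)

lemma loop_scaleC: "x \<in> D \<Longrightarrow> a *\<^sub>C x \<in> D \<and> loop k (a *\<^sub>C x) = a *\<^sub>C loop k x"
  by (simp add: closed_loop_def A_scaleC H_scaleC cinner_algebra scaleC_scaleC scaleC.diff_right
      scaleC.scaleR_right)

text \<open>The energy balance: \<open>A\<close> contributes nothing to the real part, and the
  feedback contributes the dissipation term.\<close>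

lemma Re_cinner_loop:
  assumes "x \<in> D"
  shows "Re (cinner (s *\<^sub>C x - loop k x) x) = Re s * (norm x)\<^sup>2 + k * (cmod (cinner x b))\<^sup>2"
proof -
  have "cinner x b * cinner b x = complex_of_real ((cmod (cinner x b))\<^sup>2)"
    using cinner_commute[of b x] complex_norm_square[of "cinner x b"] by simp
  then show ?thesis
    by (simp add: closed_loop_def cinner_algebra cinner_self Re_cinner_A[OF assms])
qed

text \<open>The case \<open>k = 0\<close> is included because branches start there.\<close>

lemma Re_loop_eigenvalue:
  assumes "s \<in> eigenvalues D (loop k)" "k \<ge> 0"
  shows "Re s \<le> 0"
proof -
  obtain x where x: "x \<in> D" "x \<noteq> 0" "loop k x = s *\<^sub>C x" using assms by (auto simp: eigenvalues_def)
  then have "Re s * (norm x)\<^sup>2 = - (k * (cmod (cinner x b))\<^sup>2)"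
    using Re_cinner_loop[OF x(1), of s k] by (simp add: cinner.zero_left)
  then have "Re s * (norm x)\<^sup>2 \<le> 0" using assms(2) by simp
  then show ?thesis using x by (simp add: mult_le_0_iff)
qed

text \<open>Both terms of the energy balance are nonnegative, so both vanish. The feedback then
  vanishes on \<open>x\<close>, which leaves an open-loop eigenvalue equation with \<open>x\<close>
  orthogonal to \<open>b\<close>.\<close>

lemma loop_inj:
  assumes "x \<in> D" "s *\<^sub>C x - loop k x = 0" "Re s \<ge> 0" "k > 0"
  shows "x = 0"
proof -
  have "Re s * (norm x)\<^sup>2 + k * (cmod (cinner x b))\<^sup>2 = 0"
    using Re_cinner_loop[OF assms(1), of s k] assms(2) by (simp add: cinner.zero_left)
  moreover have "Re s * (norm x)\<^sup>2 \<ge> 0" "k * (cmod (cinner x b))\<^sup>2 \<ge> 0" using assms by auto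
  ultimately have "k * (cmod (cinner x b))\<^sup>2 = 0" by linarith
  then have "cinner x b = 0" using assms(4) by simp
  moreover from this have "A x = s *\<^sub>C x"
    using assms(2) by (simp add: closed_loop_def scaleC.zero_left)
  ultimately show ?thesis using assms(1) kernel_orthogonal by blast
qed

lemma loop_resolvent_regular:
  assumes s: "s \<in> resolvent_set D A" and "Re s \<ge> 0" "k > 0"
  shows "s \<in> resolvent_set D (loop k)"
proof -
  obtain R where R: "bounded_clinear R" "\<And>v. R v \<in> D" "\<And>v. s *\<^sub>C R v - A (R v) = v"
    using s by (rule resolvent_setE) blast
  obtain K where K: "K > 0" "\<And>v. norm (R v) \<le> norm v * K"
    using bounded_linear.pos_bounded[of R] R(1) by (auto simp: bounded_clinear_def)
  define r where "r = R b"
  \<comment> \<open>The Sherman-Morrison denominator \<open>1 + k G(s)\<close>, with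
    \<open>G\<close> the transfer function. It is nonzero because \<open>G\<close> has nonnegative
    real part on the closed right half plane.\<close>
  define g where "g = 1 + k * cinner r b"
  have "Re (cinner r b) = Re (cinner r (s *\<^sub>C r - A r))" by (simp add: r_def R(3))
  also have "\<dots> = Re s * (norm r)\<^sup>2"
    using Re_cinner_A[OF R(2), of b] Re_cinner_commute[of r "A r"]
    by (simp add: cinner_algebra cinner_self r_def)
  finally have "Re g \<ge> 1" using assms by (simp add: g_def)
  then have g: "g \<noteq> 0" by auto
  show ?thesis
  proof (rule resolvent_setI[OF loop_add loop_scaleC])
    fix v
    \<comment> \<open>\<open>p\<close> is the value that \<open>cinner x b\<close> must take, found
      by pairing \<open>x = R v - k p r\<close> with \<open>b\<close>.\<close>
    define p where "p = cinner (R v) b / g"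
    define x where "x = R v + (- (k * p)) *\<^sub>C r"
    have "cinner x b = cinner (R v) b - k * p * cinner r b"
      by (simp add: x_def cinner_algebra)
    also have "\<dots> = p * (g - k * cinner r b)"
      using g by (simp add: p_def field_simps)
    finally have xb: "cinner x b = p" by (simp add: g_def)
    have rD: "r \<in> D" "s *\<^sub>C r - A r = b" by (simp_all add: r_def R)
    have Ax: "A x = A (R v) + (- (k * p)) *\<^sub>C A r"
      unfolding x_def using R(2) rD(1) H_scaleC by (simp only: A_add A_scaleC)
    have "s *\<^sub>C x - loop k x = (s *\<^sub>C R v - A (R v)) + (- (k * p)) *\<^sub>C (s *\<^sub>C r - A r) + (k * p) *\<^sub>C b"
      unfolding closed_loop_def xb Ax
      unfolding x_def
      by (simp add: scaleC_add_right scaleC_scaleC scaleC.diff_right scaleC.minus_left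
          scaleR_scaleC algebra_simps)
    then have "s *\<^sub>C x - loop k x = v" by (simp add: R(3) rD scaleC.minus_left)
    moreover have "norm x \<le> (K + k * (K * norm b / cmod g) * norm r) * norm v"
    proof -
      have "cmod (cinner (R v) b) \<le> (norm v * K) * norm b"
        using cinner_Cauchy_Schwarz[of "R v" b] K(2)[of v] mult_right_mono norm_ge_zero order_trans by blast
      then have "cmod p \<le> K * norm b / cmod g * norm v"
        by (simp add: p_def norm_divide divide_right_mono mult_ac)
      then have "k * cmod p * norm r \<le> k * (K * norm b / cmod g * norm v) * norm r"
        using assms by (intro mult_right_mono mult_left_mono) auto
      moreover have "norm x \<le> norm (R v) + k * cmod p * norm r"
        unfolding x_def using assms norm_triangle_ineq[of "R v" "(- (k * p)) *\<^sub>C r"]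
        by (simp add: norm_scaleC norm_mult)
      ultimately show ?thesis using K(2)[of v] by (simp add: algebra_simps)
    qed
    moreover have "x \<in> D" unfolding x_def using H_add H_scaleC R(2) rD by blast
    ultimately show "\<exists>x\<in>D. s *\<^sub>C x - loop k x = v \<and> norm x \<le> (K + k * (K * norm b / cmod g) * norm r) * norm v"
      by blast
  qed (use assms loop_inj in auto)
qed

text \<open>The range of \<open>\<i> t - A\<close> is orthogonal to the eigenvector
  \<open>e\<close>. Feedback supplies the missing direction, since \<open>b\<close> has a nonzero
  component along \<open>e\<close>; the rest is solved by
  \<open>inverse_at_eigenvalue\<close>.\<close>

lemma loop_resolvent_eigenvalue:
  assumes t: "eigenvalue t" and "k > 0"
  shows "\<i> * complex_of_real t \<in> resolvent_set D (loop k)"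
proof -
  let ?s = "\<i> * complex_of_real t"
  obtain e where e: "e \<in> D" "e \<noteq> 0" "shift t e = 0" using t by (auto simp: eigenvalue_def)
  have eb: "cinner e b \<noteq> 0" using e kernel_orthogonal by (auto simp: shift_eq_0_iff)
  then have be: "cinner b e \<noteq> 0" using cinner_commute[of b e] by simp
  \<comment> \<open>The eigenspace is a line: subtracting the multiple of \<open>e\<close> with the
    same inner product with \<open>b\<close> leaves a kernel vector orthogonal to
    \<open>b\<close>.\<close>
  have kernel: "\<exists>c. z = c *\<^sub>C e" if z: "z \<in> D" "shift t z = 0" for z
  proof -
    define c where "c = cinner z b / cinner e b"
    have cD: "(- c) *\<^sub>C e \<in> D" using H_scaleC e by blast
    have D: "z + (- c) *\<^sub>C e \<in> D" using H_add z cD by blast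
    have "shift t (z + (- c) *\<^sub>C e) = 0"
      unfolding shift_add[OF z(1) cD] shift_scaleC[OF e(1)] z(2) e(3)
      by (simp add: scaleC.zero_right)
    moreover have "cinner (z + (- c) *\<^sub>C e) b = 0" using eb by (simp add: cinner_algebra c_def)
    ultimately have "z + (- c) *\<^sub>C e = 0" using kernel_orthogonal[OF D] unfolding shift_eq_0_iff by blast
    then show ?thesis by (auto simp: scaleC.minus_left)
  qed
  obtain K0 where K0: "\<And>y. (\<forall>z\<in>D. shift t z = 0 \<longrightarrow> cinner y z = 0) \<Longrightarrow>
    (\<exists>x\<in>D. shift t x = y \<and> norm x \<le> K0 * norm y)"
    using inverse_at_eigenvalue[OF t] by blast
  define K where "K = max 0 K0"
  have K: "K \<ge> 0" by (simp add: K_def)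
  \<comment> \<open>Relative to \<open>norm v\<close>, the constants \<open>C1\<close>,
    \<open>C2\<close> and \<open>C3\<close> bound the scalar \<open>c\<close>, the vector
    \<open>y\<close> and the coefficient \<open>\<alpha>\<close> below.\<close>
  define C1 where "C1 = norm e / (k * cmod (cinner b e))"
  define C2 where "C2 = K * (1 + k * C1 * norm b)"
  define C3 where "C3 = (C1 + C2 * norm b) / cmod (cinner e b)"
  show ?thesis
  proof (rule resolvent_setI[OF loop_add loop_scaleC])
    fix v
    define c where "c = cinner v e / (k * cinner b e)"
    \<comment> \<open>A solution \<open>x\<close> has \<open>cinner x b = c\<close>, found by pairing the equation with \<open>e\<close>.\<close>
    define w where "w = v - (k * c) *\<^sub>C b"
    have "cinner w e = 0" using be assms by (simp add: w_def c_def cinner_algebra)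
    then have "cinner (\<i> *\<^sub>C w) z = 0" if "z \<in> D" "shift t z = 0" for z
      using kernel[OF that] by (auto simp: cinner_algebra)
    then obtain y where y: "y \<in> D" "shift t y = \<i> *\<^sub>C w" "norm y \<le> K0 * norm w"
      using K0[of "\<i> *\<^sub>C w"] by (auto simp: norm_scaleC)
    \<comment> \<open>Adding a multiple of \<open>e\<close> does not change the image under
      \<open>shift t\<close>; this freedom is spent on making \<open>cinner x b\<close> equal to
      \<open>c\<close>.\<close>
    define \<alpha> where "\<alpha> = (c - cinner y b) / cinner e b"
    define x where "x = \<alpha> *\<^sub>C e + y"
    have xD: "x \<in> D" unfolding x_def using H_add H_scaleC e y by blast
    have xb: "cinner x b = c" using eb by (simp add: x_def \<alpha>_def cinner_algebra)
    have "shift t x = \<i> *\<^sub>C w"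
      using shift_add[of "\<alpha> *\<^sub>C e" y t] shift_scaleC[OF e(1), of t \<alpha>] e y H_scaleC
      by (simp add: x_def scaleC.zero_right)
    then have "?s *\<^sub>C x - A x = w" by (simp only: conv_shift) (simp add: scaleC_scaleC)
    moreover have "?s *\<^sub>C x - loop k x = (?s *\<^sub>C x - A x) + (k * c) *\<^sub>C b"
      by (simp add: closed_loop_def xb scaleR_scaleC scaleC_scaleC)
    ultimately have eq: "?s *\<^sub>C x - loop k x = v" by (simp add: w_def)
    have n1: "cmod c \<le> C1 * norm v"
      using cinner_Cauchy_Schwarz[of v e] assms
      by (simp add: c_def C1_def norm_divide norm_mult divide_right_mono mult_ac)
    have n2: "norm y \<le> C2 * norm v"
    proof -
      have "norm w \<le> norm v + k * cmod c * norm b"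
        unfolding w_def using norm_triangle_ineq4[of v "(k * c) *\<^sub>C b"] assms
        by (simp add: norm_scaleC norm_mult)
      also have "k * cmod c * norm b \<le> k * (C1 * norm v) * norm b"
        using n1 assms by (intro mult_right_mono mult_left_mono) auto
      finally have "norm w \<le> (1 + k * C1 * norm b) * norm v" by (simp add: algebra_simps)
      from mult_left_mono[OF this K] have "K * norm w \<le> C2 * norm v" by (simp add: C2_def mult_ac)
      moreover have "K0 * norm w \<le> K * norm w" by (intro mult_right_mono) (auto simp: K_def)
      ultimately show ?thesis using y(3) by linarith
    qed
    have n3: "cmod \<alpha> \<le> C3 * norm v"
    proof -
      have "cmod (c - cinner y b) \<le> cmod c + norm y * norm b"
        using norm_triangle_ineq4[of c "cinner y b"] cinner_Cauchy_Schwarz[of y b] by linarith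
      also have "\<dots> \<le> C1 * norm v + C2 * norm v * norm b"
        using n1 n2 by (intro add_mono mult_right_mono) auto
      finally have "cmod (c - cinner y b) \<le> (C1 + C2 * norm b) * norm v" by (simp add: algebra_simps)
      from divide_right_mono[OF this, of "cmod (cinner e b)"]
      show ?thesis by (simp add: \<alpha>_def C3_def norm_divide)
    qed
    have "norm x \<le> cmod \<alpha> * norm e + norm y"
      unfolding x_def using norm_triangle_ineq[of "\<alpha> *\<^sub>C e" y] by (simp add: norm_scaleC)
    also have "\<dots> \<le> C3 * norm v * norm e + C2 * norm v"
      using n2 n3 by (intro add_mono mult_right_mono) auto
    finally have "norm x \<le> (C3 * norm e + C2) * norm v" by (simp add: algebra_simps)
    with xD eq show "\<exists>x\<in>D. ?s *\<^sub>C x - loop k x = v \<and> norm x \<le> (C3 * norm e + C2) * norm v" by blast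
  qed (use assms loop_inj[of _ ?s k] in auto)
qed

text \<open>A point outside the open left half plane either belongs to the resolvent set of
  \<open>A\<close> or is an eigenvalue of \<open>A\<close>, hence imaginary. The explicit
  closed-loop resolvents cover both cases.\<close>

lemma Re_loop_spectrum:
  assumes s: "s \<in> spectrum D (loop k)" and k: "k > 0"
  shows "Re s < 0"
proof (rule ccontr)
  assume "\<not> Re s < 0"
  then have Re: "Re s \<ge> 0" by simp
  show False
  proof (cases "s \<in> resolvent_set D A")
    case True
    from loop_resolvent_regular[OF this Re k] s show False by (simp add: spectrum_def)
  next
    case False
    then have ev: "s \<in> eigenvalues D A" using spectrum_subset by (auto simp: spectrum_def)
    then have "\<i> * complex_of_real (Im s) = s" using Re_eigenvalue by (simp add: complex_eq_iff)
    with ev loop_resolvent_eigenvalue[of "Im s" k] k s show False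
      by (simp add: eigenvalue_iff spectrum_def)
  qed
qed

end

theorem theorem6p2:
  fixes D :: "'a::chilbert_space set" and A :: "'a \<Rightarrow> 'a"
    and B :: "complex \<Rightarrow> 'a" and C :: "'a \<Rightarrow> complex"
  assumes "siso_system D A B C"
    and "collocated_skew_adjoint D A B C"
    and "minimal_system D A B C"
  shows "(\<forall>s\<in>invariant_zeros D A B C. Re s = 0) \<and>
    (\<forall>s\<in>eigenvalues D A. Re s = 0) \<and>
    interlace (Im ` invariant_zeros D A B C) (Im ` eigenvalues D A) \<and>
    (\<forall>f. root_locus_branch D A B C f \<longrightarrow> (\<forall>k\<ge>0. Re (f k) \<le> 0)) \<and>
    (\<forall>k>0. \<forall>s\<in>spectrum D (closed_loop A B C k). Re s < 0)"
proof -
  obtain b c where b: "b \<noteq> 0" and B: "B = (\<lambda>u. u *\<^sub>C b)" and C: "C = (\<lambda>x. cinner x c)"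
    using assms(1) by (auto simp: siso_system_def)
  \<comment> \<open>The relation \<open>C = B\<^sup>*\<close> is tested with the input 1 and the
    vector \<open>b - c\<close>, which forces \<open>b - c\<close> to have norm zero.\<close>
  have "(b - c, C (b - c)) \<in> adjoint_graph UNIV B"
    using assms(2) by (simp add: collocated_skew_adjoint_def graph_on_def)
  then have "cinner (B 1) (b - c) = cinner 1 (C (b - c))"
    by (simp add: adjoint_graph_def)
  then have "cinner b (b - c) = cnj (cinner (b - c) c)"
    by (simp add: B C cinner_complex_def)
  also have "\<dots> = cinner c (b - c)" by (rule cinner_commute[symmetric])
  finally have "cinner (b - c) (b - c) = 0" by (simp add: cinner.diff_left)
  then have "c = b" by (simp add: cinner_self)
  interpret collocated D A b
    using assms b
    by unfold_locales
      (auto simp: siso_system_def collocated_skew_adjoint_def minimal_system_def B C \<open>c = b\<close>)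
  show ?thesis
    using Re_zero Re_eigenvalue zeros_eigenvalues_interlace Re_loop_eigenvalue Re_loop_spectrum
    unfolding B C \<open>c = b\<close> root_locus_branch_def by blast
qed

end
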